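(* Let $X$ be a real Banach space, $G\subset X$ a nonempty open convex subset, and $\partial$ a subdifferential (in the sense of the context). The class $\mathrm{CLACG}^{\natural ad}(G)$ is subdifferentially determined in $\mathrm{CLACG}(G)$; that is, for every $g\in\mathrm{CLACG}^{\natural ad}(G)$, every $f\in\mathrm{CLACG}(G)$ and every nonempty open convex $\Omega\subset G$: if $\partial f(x)\subset\partial g(x)$ for all $x\in\Omega$, then $f=g+\text{const}$ on $\Omega$.
   Context: $X$ is a real Banach space with dual $X^*$, $G\subset X$ is nonempty, open and convex. $[x,y]:=\{x+t(y-x):t\in[0,1]\}$. Functions on $G$ are regarded as having effective domain inside $G$ (value $+\infty$ outside $G$). **Convergence in a direction.** A net $(x_\nu)$ converges to $\bar x$ in the direction $v\in X$, written $x_\nu\to_v\bar x$, if there are nets $t_\nu\searrow0$ (i.e. $t_\nu\to 0$, $t_\nu>0$) and $v_\nu\to v$ with $x_\nu=\bar x+t_\nu v_\nu$. Thus $\limsup_{x\to_v\bar x}F(x)=\inf_{\varepsilon>0}\sup\{F(\bar x+tv'):0<t<\varepsilon,\|v'-v\|<\varepsilon\}$. **Subderivatives.** For $\bar x\in\mathrm{dom} f$, $u\in X$: $f^r(\bar x;u):=\liminf_{t\searrow0}\frac{f(\bar x+tu)-f(\bar x)}{t}$; $f^\uparrow(\bar x;u):=\sup_{\delta>0}\limsup_{t\searrow0,\,(x,f(x))\to(\bar x,f(\bar x))}\inf_{u'\in B_\delta(u)}\frac{f(x+tu')-f(x)}{t}$, with $B_\delta(u)$ the ball of radius $\delta$ around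 $u$. For $\bar x\notin\mathrm{dom} f$ these are defined to be $-\infty$. Moreover, for $\bar x\in\mathrm{dom} f$, $f^{\natural}(\bar x;u):=\inf_{\alpha\ge0}\limsup_{x\to_u\bar x}f^r(x;u+\alpha(\bar x-x))$. **Subdifferential.** For $\bar x\in\mathrm{dom} f$ put $\partial_{MR}f(\bar x):=\{x^*\in X^*:\langle x^*,y-\bar x\rangle+f(\bar x)\le f(y)\ \forall y\in G\}$ and $\partial_Cf(\bar x):=\{x^*\in X^*:\langle x^*,u\rangle\le f^\uparrow(\bar x;u)\ \forall u\in X\}$ (both empty for $\bar x\notin\mathrm{dom} f$). A subdifferential is an operator $\partial$ that associates a set-valued mapping $\partial f:G\rightrightarrows X^*$ (identified with its graph) to each function $f:G\to\,]-\infty,+\infty]$ so that $\partial_{MR}f\subset\partial f\subset\partial_Cf$ and the following Separation Principle holds: for any lower semicontinuous $f,\varphi$ on $G$ with $\varphi$ convex and Lipschitz near $\bar x\in\mathrm{dom} f$, if $f+\varphi$ admits a local minimum at $\bar x$, then $0\in\widehat\partial f(\bar x)+\partial\varphi(\bar x)$, where $\widehat\partial f(\bar x)$ is the set of $\bar x^*\in X^*$ for which there is a net $((x_\nu,x_\nu^* ))_\nu\subset\partial f$ with $(x_\nu,f(x_\nu))\to(\bar x,f(\bar x))$, $x_\nu^*\to\bar x^*$ weak$^*$, and $\limsup_\nu\langle x_\nu^*,x_\nu-\bar x\rangle\le0$. **ACG.** For $\varphi:[a,b]\to\mathbb R$ and $S\subset[a,b]$, $\varphi$ is AC on $S$ if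 for each $\varepsilon>0$ there is $\delta>0$ such that $\sum_{i=1}^n|\varphi(d_i)-\varphi(c_i)|<\varepsilon$ whenever $\{[c_i,d_i]\}_{i=1}^n$ is a finite collection of non-overlapping intervals with endpoints in $S$ and $\sum(d_i-c_i)<\delta$. $\varphi$ is ACG on $S$ if $\varphi|_S$ is continuous and $S$ is a countable union of sets on each of which $\varphi$ is AC. **Classes.** $\mathrm{CLACG}(G)$ is the class of all real-valued continuous functions on $G$ whose restrictions to line segments $[a,b]\subset G$ are ACG (i.e. $t\mapsto f(a+t(b-a))$ is ACG on $[0,1]$). $\mathrm{CLACG}^{\natural ad}(G)$ is the class of $g\in\mathrm{CLACG}(G)$ such that for every $[\bar x,\bar x+u]\subset G$ there exist sequences $\bar x_n\to\bar x$, $u_n\to u$ such that for every $n$: $g^r(\bar x_n+tu_n;u_n)\in\mathbb R$ and $g^{\natural}(\bar x_n+tu_n;u_n)=g^r(\bar x_n+tu_n;u_n)$ for (Lebesgue) almost all $t\in[0,1]$. *)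

theory Defs
  imports "HOL-Analysis.Analysis"
begin

text \<open>
  A function \<open>G \<rightarrow> ]-\<infinity>, +\<infinity>]\<close> is represented by a total \<^typ>\<open>ereal\<close>-valued function that
  is \<open>+\<infinity>\<close> outside \<open>G\<close>, so that it is determined by its values on \<open>G\<close>; the dual space is
  the type \<open>'a \<Rightarrow>\<^sub>L real\<close> of bounded linear functionals.
\<close>

definition extended_functions :: "'a set \<Rightarrow> ('a \<Rightarrow> ereal) set" where
  "extended_functions G = {f. (\<forall>x. f x \<noteq> -\<infinity>) \<and> (\<forall>x. x \<notin> G \<longrightarrow> f x = \<infinity>)}"

definition extend :: "'a set \<Rightarrow> ('a \<Rightarrow> real) \<Rightarrow> 'a \<Rightarrow> ereal" where
  "extend G f = (\<lambda>x. if x \<in> G then ereal (f x) else \<infinity>)"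

definition edom :: "('a \<Rightarrow> ereal) \<Rightarrow> 'a set" where
  "edom f = {x. f x < \<infinity>}"


subsection \<open>Directional convergence and subderivatives\<close>

text \<open>
  The filter of \<open>x \<rightarrow>\<^sub>v xb\<close>: it is generated by the sets
  \<open>{xb + t v' | 0 < t < \<epsilon>, norm (v' - v) < \<epsilon>}\<close>, \<open>\<epsilon> > 0\<close>.
\<close>

definition at_direction :: "'a::real_normed_vector \<Rightarrow> 'a \<Rightarrow> 'a filter" where
  "at_direction xb v =
     filtermap (\<lambda>(t, v'). xb + t *\<^sub>R v') (at_right (0::real) \<times>\<^sub>F nhds v)"

definition radial_subderivative :: "('a::real_normed_vector \<Rightarrow> ereal) \<Rightarrow> 'a \<Rightarrow> 'a \<Rightarrow> ereal" where
  "radial_subderivative f xb u =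
     (if xb \<in> edom f
      then Liminf (at_right 0) (\<lambda>t. (f (xb + t *\<^sub>R u) - f xb) / ereal t)
      else -\<infinity>)"

text \<open>
  The filter \<open>filtercomap (\<lambda>x. (x, f x)) (nhds (xb, f xb))\<close> expresses
  \<open>(x, f x) \<rightarrow> (xb, f xb)\<close>; the point \<open>x = xb\<close> is not excluded.
\<close>

definition upper_subderivative :: "('a::real_normed_vector \<Rightarrow> ereal) \<Rightarrow> 'a \<Rightarrow> 'a \<Rightarrow> ereal" where
  "upper_subderivative f xb u =
     (if xb \<in> edom f
      then (SUP \<delta>\<in>{0<..}.
              Limsup (at_right (0::real) \<times>\<^sub>F filtercomap (\<lambda>x. (x, f x)) (nhds (xb, f xb)))
                (\<lambda>(t, x). INF u'\<in>ball u \<delta>. (f (x + t *\<^sub>R u') - f x) / ereal t))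
      else -\<infinity>)"

text \<open>The notion is only meant for \<open>xb \<in> edom f\<close>; the value \<open>-\<infinity>\<close> elsewhere is a convention.\<close>

definition natural_subderivative :: "('a::real_normed_vector \<Rightarrow> ereal) \<Rightarrow> 'a \<Rightarrow> 'a \<Rightarrow> ereal" where
  "natural_subderivative f xb u =
     (if xb \<in> edom f
      then (INF \<alpha>\<in>{0..}. Limsup (at_direction xb u)
              (\<lambda>x. radial_subderivative f x (u + \<alpha> *\<^sub>R (xb - x))))
      else -\<infinity>)"


subsection \<open>Subdifferentials\<close>

definition moreau_rockafellar_subdifferential ::
    "'a::real_normed_vector set \<Rightarrow> ('a \<Rightarrow> ereal) \<Rightarrow> 'a \<Rightarrow> ('a \<Rightarrow>\<^sub>L real) set" where
  "moreau_rockafellar_subdifferential G f xb =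
     {xs. xb \<in> edom f \<and> (\<forall>y\<in>G. ereal (blinfun_apply xs (y - xb)) + f xb \<le> f y)}"

definition clarke_subdifferential ::
    "('a::real_normed_vector \<Rightarrow> ereal) \<Rightarrow> 'a \<Rightarrow> ('a \<Rightarrow>\<^sub>L real) set" where
  "clarke_subdifferential f xb =
     {xs. xb \<in> edom f \<and> (\<forall>u. ereal (blinfun_apply xs u) \<le> upper_subderivative f xb u)}"

text \<open>
  Nets \<open>(x\<^sub>\<nu>, x\<^sub>\<nu>\<^sup>*)\<close> in the graph of a set-valued mapping are rendered by proper filters \<open>F\<close> on
  pairs that contain this graph: a net gives the filter of the sets in which it eventually lies,
  and every proper filter arises in this way. Weak* convergence is pointwise convergence.
\<close>

definition limiting_subdifferential ::
    "(('a::real_normed_vector \<Rightarrow> ereal) \<Rightarrow> 'a \<Rightarrow> ('a \<Rightarrow>\<^sub>L real) set)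
       \<Rightarrow> ('a \<Rightarrow> ereal) \<Rightarrow> 'a \<Rightarrow> ('a \<Rightarrow>\<^sub>L real) set" where
  "limiting_subdifferential D f xb =
     {xbs. \<exists>F :: ('a \<times> ('a \<Rightarrow>\<^sub>L real)) filter. F \<noteq> bot
        \<and> (\<forall>\<^sub>F (x, xs) in F. xs \<in> D f x)
        \<and> ((\<lambda>(x, xs). (x, f x)) \<longlongrightarrow> (xb, f xb)) F
        \<and> (\<forall>v. ((\<lambda>(x, xs). blinfun_apply xs v) \<longlongrightarrow> blinfun_apply xbs v) F)
        \<and> Limsup F (\<lambda>(x, xs). ereal (blinfun_apply xs (x - xb))) \<le> 0}"

definition lsc_on :: "'a::topological_space set \<Rightarrow> ('a \<Rightarrow> ereal) \<Rightarrow> bool" where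
  "lsc_on G f \<longleftrightarrow> (\<forall>x\<in>G. f x \<le> Liminf (at x within G) f)"

definition ereal_convex_on :: "'a::real_vector set \<Rightarrow> ('a \<Rightarrow> ereal) \<Rightarrow> bool" where
  "ereal_convex_on G f \<longleftrightarrow>
     (\<forall>x\<in>G. \<forall>y\<in>G. \<forall>t\<in>{0<..<1}.
        f ((1 - t) *\<^sub>R x + t *\<^sub>R y) \<le> ereal (1 - t) * f x + ereal t * f y)"

definition lipschitz_near :: "('a::metric_space \<Rightarrow> ereal) \<Rightarrow> 'a \<Rightarrow> bool" where
  "lipschitz_near f xb \<longleftrightarrow>
     (\<exists>\<epsilon>>0. \<exists>L. (\<forall>x\<in>ball xb \<epsilon>. \<bar>f x\<bar> \<noteq> \<infinity>)
        \<and> L-lipschitz_on (ball xb \<epsilon>) (\<lambda>x. real_of_ereal (f x)))"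

definition separation_principle ::
    "'a::real_normed_vector set
       \<Rightarrow> (('a \<Rightarrow> ereal) \<Rightarrow> 'a \<Rightarrow> ('a \<Rightarrow>\<^sub>L real) set) \<Rightarrow> bool" where
  "separation_principle G D \<longleftrightarrow>
     (\<forall>f\<in>extended_functions G. \<forall>\<phi>\<in>extended_functions G. \<forall>xb\<in>edom f.
        lsc_on G f \<and> lsc_on G \<phi> \<and> ereal_convex_on G \<phi> \<and> lipschitz_near \<phi> xb
        \<and> (\<forall>\<^sub>F y in nhds xb. f xb + \<phi> xb \<le> f y + \<phi> y)
        \<longrightarrow> (\<exists>xs\<in>limiting_subdifferential D f xb. \<exists>ys\<in>D \<phi> xb. 0 = xs + ys))"

text \<open>
  For \<open>f \<in> extended_functions G\<close> the inclusions force \<open>D f x = {}\<close> for \<open>x \<notin> G\<close>, so \<open>D f\<close> is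
  a set-valued mapping on \<open>G\<close>.
\<close>

definition is_subdifferential ::
    "'a::real_normed_vector set
       \<Rightarrow> (('a \<Rightarrow> ereal) \<Rightarrow> 'a \<Rightarrow> ('a \<Rightarrow>\<^sub>L real) set) \<Rightarrow> bool" where
  "is_subdifferential G D \<longleftrightarrow>
     (\<forall>f\<in>extended_functions G. \<forall>x.
        moreau_rockafellar_subdifferential G f x \<subseteq> D f x \<and> D f x \<subseteq> clarke_subdifferential f x)
     \<and> separation_principle G D"


subsection \<open>The function classes\<close>

definition AC_on :: "real set \<Rightarrow> (real \<Rightarrow> real) \<Rightarrow> bool" where
  "AC_on S \<phi> \<longleftrightarrow>
     (\<forall>\<epsilon>>0. \<exists>\<delta>>0. \<forall>(n::nat) c d.
        (\<forall>i<n. c i \<in> S \<and> d i \<in> S \<and> c i < d i)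
        \<and> (\<forall>i<n. \<forall>j<n. i \<noteq> j \<longrightarrow> {c i<..<d i} \<inter> {c j<..<d j} = {})
        \<and> (\<Sum>i<n. d i - c i) < \<delta>
        \<longrightarrow> (\<Sum>i<n. \<bar>\<phi> (d i) - \<phi> (c i)\<bar>) < \<epsilon>)"

definition ACG_on :: "real set \<Rightarrow> (real \<Rightarrow> real) \<Rightarrow> bool" where
  "ACG_on S \<phi> \<longleftrightarrow>
     continuous_on S \<phi> \<and> (\<exists>A :: nat \<Rightarrow> real set. S = (\<Union>n. A n) \<and> (\<forall>n. AC_on (A n) \<phi>))"

definition CLACG :: "'a::real_normed_vector set \<Rightarrow> ('a \<Rightarrow> real) set" where
  "CLACG G =
     {f. continuous_on G f
       \<and> (\<forall>a b. closed_segment a b \<subseteq> G \<longrightarrow> ACG_on {0..1} (\<lambda>t. f (a + t *\<^sub>R (b - a))))}"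

definition CLACG_natural_ad :: "'a::real_normed_vector set \<Rightarrow> ('a \<Rightarrow> real) set" where
  "CLACG_natural_ad G =
     {g \<in> CLACG G. \<forall>xb u. closed_segment xb (xb + u) \<subseteq> G \<longrightarrow>
        (\<exists>X U. X \<longlonglongrightarrow> xb \<and> U \<longlonglongrightarrow> u \<and>
           (\<forall>n::nat. AE t in lebesgue_on {0..1}.
              \<bar>radial_subderivative (extend G g) (X n + t *\<^sub>R U n) (U n)\<bar> \<noteq> \<infinity>
              \<and> natural_subderivative (extend G g) (X n + t *\<^sub>R U n) (U n)
                = radial_subderivative (extend G g) (X n + t *\<^sub>R U n) (U n)))}"

definition subdifferentially_determined_in ::
    "'a::real_normed_vector set \<Rightarrow> (('a \<Rightarrow> ereal) \<Rightarrow> 'a \<Rightarrow> ('a \<Rightarrow>\<^sub>L real) set)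
       \<Rightarrow> ('a \<Rightarrow> real) set \<Rightarrow> ('a \<Rightarrow> real) set \<Rightarrow> bool" where
  "subdifferentially_determined_in G D \<A> \<B> \<longleftrightarrow>
     (\<forall>g\<in>\<A>. \<forall>f\<in>\<B>. \<forall>\<Omega>. \<Omega> \<noteq> {} \<and> open \<Omega> \<and> convex \<Omega> \<and> \<Omega> \<subseteq> G
        \<and> (\<forall>x\<in>\<Omega>. D (extend G f) x \<subseteq> D (extend G g) x)
        \<longrightarrow> (\<exists>c. \<forall>x\<in>\<Omega>. f x = g x + c))"

end

theory Submission
  imports Defs
begin

text \<open>
  Why the theorem holds. Everything is reduced to one inequality between subderivatives: if
  \<open>\<partial>f \<subseteq> \<partial>g\<close> on \<open>\<Omega>\<close>, then \<open>f\<^sup>r(x; u)\<close> is at most the natural subderivative of \<open>g\<close> at \<open>x\<close> in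
  the direction \<open>u\<close>, for all \<open>x\<close> in \<open>\<Omega>\<close> and all \<open>u \<noteq> 0\<close> (\<open>radial_le_natural_subderivative\<close>).

  The inequality has two halves, both expressed through the direction
  \<open>w(x) = u + \<alpha> (xb - x)\<close> that enters the definition of the natural subderivative. For \<open>\<alpha> > 0\<close> this
  vector points from \<open>x\<close> towards the fixed target \<open>xb + u/\<alpha>\<close>, so it keeps its direction, and is only
  shortened, when \<open>x\<close> moves along it; for \<open>\<alpha> = 0\<close> it is constant.
  On the side of \<open>f\<close>, every \<open>\<mu> < f\<^sup>r(xb; u)\<close> is almost attained by limiting subgradients:
  the restriction of \<open>f - \<mu> t\<close> to a short segment in the direction \<open>u\<close> has a minimiser that is not
  the far endpoint; penalising the distance to the segment and applying Ekeland's principle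
  gives a nearby point at which \<open>f\<close> plus a convex Lipschitz function has a local minimum, and the
  Separation Principle yields there a limiting subgradient whose value at \<open>w\<close> is not much below \<open>\<mu>\<close>
  (\<open>separation_at_directional_point\<close>). On the side of \<open>g\<close>, subgradients are bounded
  by the upper subderivative, and following \<open>w\<close> along a line shows that
  the upper subderivative at a point is bounded by nearby radial subderivatives
  (\<open>upper_subderivative_le_radial_bound\<close>).

  On a segment along which the natural and the radial subderivative of \<open>g\<close> agree and are finite
  almost everywhere, the lower Dini derivative of \<open>f - g\<close> is therefore nonpositive almost
  everywhere. Since \<open>f - g\<close> is ACG there, it maps the exceptional null set to a null set, which
  keeps a continuous function with nonpositive lower Dini derivative from increasing
  (\<open>growth_off_negligible_image\<close>). Such segments approximate every segment, so by continuity
  \<open>f - g\<close> does not increase from any point of \<open>\<Omega>\<close> to any other; exchanging the two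
  points, \<open>f - g\<close> is constant.
\<close>


section \<open>Continuous functions with nonpositive lower Dini derivative\<close>

text \<open>
  Since \<open>h ` N\<close> is null, some value strictly between \<open>h a\<close> and a larger \<open>h b\<close> is not
  taken on \<open>N\<close>. At the last point where \<open>h\<close> takes this value it can no longer descend, so that point
  would have to lie in \<open>N\<close>. Only the image of the exceptional set has to be small.
\<close>

lemma growth_off_negligible_image:
  fixes h :: "real \<Rightarrow> real"
  assumes ab: "a \<le> b" and cont: "continuous_on {a..b} h" and null: "negligible (h ` N)"
    and descend: "\<And>s. \<lbrakk>a \<le> s; s < b; s \<notin> N\<rbrakk> \<Longrightarrow> \<exists>s'. s < s' \<and> s' \<le> b \<and> h s' < h s"
  shows "h b \<le> h a"
proof (rule ccontr)
  assume "\<not> h b \<le> h a"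
  then have "{h a<..<h b} \<noteq> {}" by auto
  then have "\<not> {h a<..<h b} \<subseteq> h ` N"
    using open_not_negligible[of "{h a<..<h b}"] negligible_subset[OF null] by auto
  then obtain y where "y \<in> {h a<..<h b}" and "y \<notin> h ` N" by blast
  then have y: "h a < y" "y < h b" "y \<notin> h ` N" by auto
  define L where "L = {s\<in>{a..b}. h s \<le> y}"
  have "closed L"
    unfolding L_def using continuous_closed_preimage[OF cont _ closed_atMost[of y]]
    by (simp add: vimage_def Int_def conj_commute)
  moreover have "bounded L"
    by (rule bounded_subset[of "{a..b}"]) (auto simp: L_def)
  ultimately have "compact L" using compact_eq_bounded_closed by blast
  moreover have "L \<noteq> {}" using ab y by (auto simp: L_def)
  ultimately obtain t where t: "t \<in> L" "\<And>s. s \<in> L \<Longrightarrow> s \<le> t"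
    using compact_attains_sup[of L] by auto
  have tb: "a \<le> t" "t < b" "h t \<le> y" using t y by (auto simp: L_def intro: le_neq_trans)
  obtain s where s: "t \<le> s" "s \<le> b" "h s = y"
    using IVT'[of h t y b] tb y continuous_on_subset[OF cont, of "{t..b}"] by auto
  have "s \<in> L" using s tb by (auto simp: L_def)
  then have "s = t" using t(2) s(1) by force
  then have "t \<notin> N" using s(3) y(3) by auto
  then obtain s' where "t < s'" "s' \<le> b" "h s' < h t" using descend tb by blast
  then have "s' \<in> L" using tb by (auto simp: L_def)
  then show False using t(2) \<open>t < s'\<close> by force
qed


section \<open>ACG functions map null sets to null sets\<close>

text \<open>
  The condition inside \<^const>\<open>AC_on\<close> for fixed \<open>\<delta>\<close> and \<open>\<epsilon>\<close>, without its two quantifiers, so that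
  moduli of continuity can be combined without unfolding the condition on families of intervals.
\<close>

definition varies_less :: "real set \<Rightarrow> (real \<Rightarrow> real) \<Rightarrow> real \<Rightarrow> real \<Rightarrow> bool" where
  "varies_less S \<phi> \<delta> \<epsilon> \<longleftrightarrow>
     (\<forall>(n::nat) c d.
        (\<forall>i<n. c i \<in> S \<and> d i \<in> S \<and> c i < d i)
        \<and> (\<forall>i<n. \<forall>j<n. i \<noteq> j \<longrightarrow> {c i<..<d i} \<inter> {c j<..<d j} = {})
        \<and> (\<Sum>i<n. d i - c i) < \<delta>
        \<longrightarrow> (\<Sum>i<n. \<bar>\<phi> (d i) - \<phi> (c i)\<bar>) < \<epsilon>)"

lemma AC_on_iff_varies_less: "AC_on S \<phi> \<longleftrightarrow> (\<forall>\<epsilon>>0. \<exists>\<delta>>0. varies_less S \<phi> \<delta> \<epsilon>)"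
  unfolding AC_on_def varies_less_def ..

lemma varies_less_subset:
  assumes "varies_less S \<phi> \<delta> \<epsilon>" "T \<subseteq> S" shows "varies_less T \<phi> \<delta> \<epsilon>"
  unfolding varies_less_def
proof (intro allI impI)
  fix n :: nat and c d
  assume "(\<forall>i<n. c i \<in> T \<and> d i \<in> T \<and> c i < d i)
        \<and> (\<forall>i<n. \<forall>j<n. i \<noteq> j \<longrightarrow> {c i<..<d i} \<inter> {c j<..<d j} = {})
        \<and> (\<Sum>i<n. d i - c i) < \<delta>"
  then show "(\<Sum>i<n. \<bar>\<phi> (d i) - \<phi> (c i)\<bar>) < \<epsilon>"
    using assms(2) by (intro assms(1)[unfolded varies_less_def, rule_format]) auto
qed

lemma varies_less_diff:
  assumes "varies_less S \<phi> \<delta>1 \<epsilon>1" "varies_less S \<psi> \<delta>2 \<epsilon>2"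
  shows "varies_less S (\<lambda>t. \<phi> t - \<psi> t) (min \<delta>1 \<delta>2) (\<epsilon>1 + \<epsilon>2)"
  unfolding varies_less_def
proof (intro allI impI)
  fix n :: nat and c d
  assume H: "(\<forall>i<n. c i \<in> S \<and> d i \<in> S \<and> c i < d i)
        \<and> (\<forall>i<n. \<forall>j<n. i \<noteq> j \<longrightarrow> {c i<..<d i} \<inter> {c j<..<d j} = {})
        \<and> (\<Sum>i<n. d i - c i) < min \<delta>1 \<delta>2"
  have "(\<Sum>i<n. \<bar>\<phi> (d i) - \<psi> (d i) - (\<phi> (c i) - \<psi> (c i))\<bar>)
      \<le> (\<Sum>i<n. \<bar>\<phi> (d i) - \<phi> (c i)\<bar> + \<bar>\<psi> (d i) - \<psi> (c i)\<bar>)"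
    by (rule sum_mono) linarith
  also have "\<dots> < \<epsilon>1 + \<epsilon>2"
    unfolding sum.distrib
    using H by (intro add_strict_mono assms[unfolded varies_less_def, rule_format]) auto
  finally show "(\<Sum>i<n. \<bar>\<phi> (d i) - \<psi> (d i) - (\<phi> (c i) - \<psi> (c i))\<bar>) < \<epsilon>1 + \<epsilon>2" .
qed

text \<open>
  Families of intervals are indexed below by the intervals of a covering rather than by numbers.
\<close>

lemma varies_less_finite:
  assumes "varies_less S \<phi> \<delta> \<epsilon>" and I: "finite I" "\<And>i. i \<in> I \<Longrightarrow> c i \<in> S \<and> d i \<in> S \<and> c i < d i"
    "pairwise (\<lambda>i j. {c i<..<d i} \<inter> {c j<..<d j} = {}) I" "(\<Sum>i\<in>I. d i - c i) < \<delta>"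
  shows "(\<Sum>i\<in>I. \<bar>\<phi> (d i) - \<phi> (c i)\<bar>) < \<epsilon>"
proof -
  obtain e where e: "bij_betw e {..<card I} I"
    using ex_bij_betw_nat_finite[OF I(1)] atLeast0LessThan by metis
  have eI: "e i \<in> I" if "i < card I" for i using e that by (auto simp: bij_betw_def)
  have einj: "e i \<noteq> e j" if "i < card I" "j < card I" "i \<noteq> j" for i j
    using e that by (auto simp: bij_betw_def inj_on_def)
  have "(\<Sum>i<card I. d (e i) - c (e i)) < \<delta>"
    using I(4) sum.reindex_bij_betw[OF e, of "\<lambda>i. d i - c i"] by simp
  then have "(\<Sum>i<card I. \<bar>\<phi> (d (e i)) - \<phi> (c (e i))\<bar>) < \<epsilon>"
    using I eI einj by (intro assms(1)[unfolded varies_less_def, rule_format]) (auto simp: pairwise_def)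
  then show ?thesis
    using sum.reindex_bij_betw[OF e, of "\<lambda>i. \<bar>\<phi> (d i) - \<phi> (c i)\<bar>"] by simp
qed

lemma AC_on_subset: "AC_on S \<phi> \<Longrightarrow> T \<subseteq> S \<Longrightarrow> AC_on T \<phi>"
  unfolding AC_on_iff_varies_less by (meson varies_less_subset)

lemma AC_on_diff:
  assumes "AC_on S \<phi>" "AC_on S \<psi>"
  shows "AC_on S (\<lambda>t. \<phi> t - \<psi> t)"
  unfolding AC_on_iff_varies_less
proof (intro allI impI)
  fix \<epsilon> :: real assume "\<epsilon> > 0"
  then have "\<epsilon>/2 > 0" by simp
  then obtain \<delta>1 \<delta>2 where "\<delta>1 > 0" "varies_less S \<phi> \<delta>1 (\<epsilon>/2)" "\<delta>2 > 0" "varies_less S \<psi> \<delta>2 (\<epsilon>/2)"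
    using assms unfolding AC_on_iff_varies_less by meson
  then show "\<exists>\<delta>>0. varies_less S (\<lambda>t. \<phi> t - \<psi> t) \<delta> \<epsilon>"
    using varies_less_diff by (intro exI[of _ "min \<delta>1 \<delta>2"]) fastforce
qed

lemma AC_on_linear: "AC_on S (\<lambda>t. k * t)"
  unfolding AC_on_iff_varies_less
proof (intro allI impI)
  fix \<epsilon> :: real assume e: "\<epsilon> > 0"
  have "varies_less S (\<lambda>t. k * t) (\<epsilon> / (\<bar>k\<bar> + 1)) \<epsilon>"
    unfolding varies_less_def
  proof (intro allI impI)
    fix n :: nat and c d :: "nat \<Rightarrow> real"
    assume H: "(\<forall>i<n. c i \<in> S \<and> d i \<in> S \<and> c i < d i)
        \<and> (\<forall>i<n. \<forall>j<n. i \<noteq> j \<longrightarrow> {c i<..<d i} \<inter> {c j<..<d j} = {})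
        \<and> (\<Sum>i<n. d i - c i) < \<epsilon> / (\<bar>k\<bar> + 1)"
    have "(\<Sum>i<n. \<bar>k * d i - k * c i\<bar>) = (\<Sum>i<n. \<bar>k\<bar> * (d i - c i))"
      by (rule sum.cong) (use H in \<open>auto simp: abs_mult simp flip: right_diff_distrib\<close>)
    also have "\<dots> \<le> (\<bar>k\<bar> + 1) * (\<Sum>i<n. d i - c i)"
      unfolding sum_distrib_left by (rule sum_mono) (use H in \<open>auto intro!: mult_right_mono\<close>)
    also have "\<dots> < \<epsilon>" using H by (auto simp: field_simps)
    finally show "(\<Sum>i<n. \<bar>k * d i - k * c i\<bar>) < \<epsilon>" .
  qed
  then show "\<exists>\<delta>>0. varies_less S (\<lambda>t. k * t) \<delta> \<epsilon>"
    using e by (intro exI[of _ "\<epsilon> / (\<bar>k\<bar> + 1)"]) auto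
qed

lemma open_interval_subset_interior:
  fixes x y :: real
  assumes "K = cbox c d" "x \<in> K" "y \<in> K"
  shows "{x<..<y} \<subseteq> interior K"
  using assms by (auto simp: interior_atLeastAtMost_real)

text \<open>
  Cover \<open>E\<close> by nonoverlapping closed intervals inside an open set of measure less than \<open>\<delta>\<close>.
  On each of them the image of \<open>E\<close> lies in an interval whose length is comparable to
  \<open>\<bar>\<phi> y - \<phi> x\<bar>\<close> for two points \<open>x\<close>, \<open>y\<close> of \<open>E\<close> that nearly realise the oscillation. Absolute
  continuity bounds the sum of these differences. The covering needs a bounded set; the general
  case is a countable union.
\<close>

lemma AC_on_negligible_image:
  assumes AC: "AC_on E \<phi>" and E: "negligible E"
  shows "negligible (\<phi> ` E)"
proof -
  have bdd: "negligible (\<phi> ` E)" if AC: "AC_on E \<phi>" and E: "negligible E" "E \<subseteq> {a..b}" and ab: "a < b" for E a b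
    unfolding negligible_outer_le
  proof (intro allI impI)
    fix \<epsilon> :: real assume "\<epsilon> > 0"
    then have "\<epsilon>/4 > 0" by simp
    then obtain \<delta> where \<delta>: "\<delta> > 0" and ACd: "varies_less E \<phi> \<delta> (\<epsilon>/4)"
      using AC unfolding AC_on_iff_varies_less by blast
    have Es: "E \<in> sets lebesgue" using E by (simp add: negligible_imp_sets)
    obtain U where U: "open U" "E \<subseteq> U" "U - E \<in> lmeasurable" "emeasure lebesgue (U - E) < ennreal \<delta>"
      using sets_lebesgue_outer_open[OF Es \<delta>] .
    have Un: "U = (U - E) \<union> E" using U(2) by auto
    have UM: "U \<in> lmeasurable" 
      by (subst Un) (intro fmeasurable.Un U negligible_imp_measurable E)
    have "measure lebesgue U \<le> measure lebesgue (U - E) + measure lebesgue E"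
      by (subst Un, rule measure_Un_le) (use U E in \<open>auto simp: fmeasurableD Es\<close>)
    also have "\<dots> < \<delta>" using U(3,4) E \<delta>
      by (simp add: negligible_imp_measure0 emeasure_eq_measure2 ennreal_less_iff)
    finally have U\<delta>: "measure lebesgue U < \<delta>" .
    obtain \<D> :: "real set set" where \<D>: "countable \<D>"
        "\<And>K. K \<in> \<D> \<Longrightarrow> interior K \<noteq> {} \<and> (\<exists>c d. K = cbox c d)"
        "pairwise (\<lambda>A B. interior A \<inter> interior B = {}) \<D>"
        "\<And>K. K \<in> \<D> \<Longrightarrow> \<exists>x \<in> E \<inter> K. K \<subseteq> (if x \<in> U then U else UNIV)"
        "E \<subseteq> \<Union>\<D>"
      by (rule covering_lemma[of E a b "\<lambda>x. if x \<in> U then U else UNIV"])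
        (use E ab U in \<open>auto simp: gauge_def\<close>)
    have len: "(\<Sum>K\<in>F. d K - c K) < \<delta>"
      if F: "finite F" "F \<subseteq> \<D>" and cd: "\<And>K. K \<in> F \<Longrightarrow> c K \<in> E \<inter> K \<and> d K \<in> E \<inter> K \<and> c K < d K"
      for F and c d :: "real set \<Rightarrow> real"
    proof -
      have sub: "{c K<..<d K} \<subseteq> interior K" if "K \<in> F" for K
      proof -
        obtain p q where "K = cbox p q" using \<D>(2)[of K] F \<open>K \<in> F\<close> by blast
        then show ?thesis using cd[OF that] by (intro open_interval_subset_interior) auto
      qed
      have dis: "disjoint_family_on (\<lambda>K. {c K<..<d K}) F"
        unfolding disjoint_family_on_def
      proof (intro ballI impI)
        fix K L assume KL: "K \<in> F" "L \<in> F" "K \<noteq> L"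
        then have "interior K \<inter> interior L = {}" using \<D>(3) F by (auto simp: pairwise_def)
        then show "{c K<..<d K} \<inter> {c L<..<d L} = {}" using sub[OF KL(1)] sub[OF KL(2)] by blast
      qed
      have KU: "K \<subseteq> U" if "K \<in> F" for K
      proof -
        obtain v where "v \<in> E \<inter> K" "K \<subseteq> (if v \<in> U then U else UNIV)"
          using \<D>(4)[of K] F \<open>K \<in> F\<close> by blast
        moreover from this U(2) have "v \<in> U" by blast
        ultimately show ?thesis by simp
      qed
      have "(\<Sum>K\<in>F. d K - c K) = (\<Sum>K\<in>F. measure lebesgue {c K<..<d K})"
        by (rule sum.cong) (use cd in \<open>auto simp: less_imp_le\<close>)
      also have "\<dots> = measure lebesgue (\<Union>K\<in>F. {c K<..<d K})"
        by (rule measure_finite_Union[symmetric, OF F(1) _ dis]) (use cd in \<open>auto simp: emeasure_lborel_Ioo less_imp_le\<close>)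
      also have "\<dots> \<le> measure lebesgue U"
      proof (rule measure_mono_fmeasurable[OF _ _ UM])
        show "(\<Union>K\<in>F. {c K<..<d K}) \<subseteq> U"
          using KU sub interior_subset by (meson UN_least order_trans)
      qed (use F in auto)
      also have "\<dots> < \<delta>" by (rule U\<delta>)
      finally show ?thesis .
    qed
    have "\<exists>x y z. x \<in> E \<inter> K \<and> y \<in> E \<inter> K \<and> x \<le> y
        \<and> \<phi> ` (E \<inter> K) \<subseteq> {z - 2 * \<bar>\<phi> y - \<phi> x\<bar> .. z + 2 * \<bar>\<phi> y - \<phi> x\<bar>}" if K: "K \<in> \<D>" for K
    proof -
      obtain p where p: "p \<in> E \<inter> K" using \<D>(4)[OF K] by blast
      define q where "q a = \<bar>\<phi> a - \<phi> p\<bar>" for a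
      have single: "\<bar>\<phi> d - \<phi> c\<bar> < \<epsilon>/4" if "c \<in> E \<inter> K" "d \<in> E \<inter> K" "c < d" for c d
        using varies_less_finite[OF ACd, of "{K}" "\<lambda>_. c" "\<lambda>_. d"] len[of "{K}" "\<lambda>_. c" "\<lambda>_. d"] that K by auto
      have q: "q a \<le> \<epsilon>/4" if "a \<in> E \<inter> K" for a
        using single[of a p] single[of p a] that p \<open>\<epsilon> > 0\<close> abs_minus_commute[of "\<phi> p" "\<phi> a"]
        unfolding q_def by (cases a p rule: linorder_cases) auto
      have bd: "bdd_above (q ` (E \<inter> K))" using q by (intro bdd_aboveI[of _ "\<epsilon>/4"]) auto
      define \<sigma> where "\<sigma> = (SUP a\<in>E \<inter> K. q a)"
      have le: "q a \<le> \<sigma>" if "a \<in> E \<inter> K" for a unfolding \<sigma>_def by (rule cSUP_upper[OF that bd])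
      obtain a where a: "a \<in> E \<inter> K" "\<sigma> \<le> 2 * q a"
      proof (cases "\<sigma> \<le> 0")
        case True then show ?thesis using that[OF p] by (simp add: q_def)
      next
        case False
        then have "\<sigma>/2 < (SUP a\<in>E \<inter> K. q a)" by (simp add: \<sigma>_def)
        then obtain a where "a \<in> E \<inter> K" "\<sigma>/2 < q a"
          using less_cSUP_iff[OF _ bd] p by blast
        then show ?thesis using that[of a] by simp
      qed
      have "\<phi> ` (E \<inter> K) \<subseteq> {\<phi> p - 2 * q a .. \<phi> p + 2 * q a}"
        using le a(2) unfolding q_def by fastforce
      then have im: "\<phi> ` (E \<inter> K) \<subseteq> {\<phi> p - 2 * \<bar>\<phi> a - \<phi> p\<bar> .. \<phi> p + 2 * \<bar>\<phi> a - \<phi> p\<bar>}"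
        by (simp add: q_def)
      show ?thesis
      proof (cases "a \<le> p")
        case True
        then show ?thesis using p a(1) im
          by (intro exI[of _ a] exI[of _ p] exI[of _ "\<phi> p"]) (simp add: abs_minus_commute[of "\<phi> p"])
      next
        case False
        then show ?thesis using p a(1) im
          by (intro exI[of _ p] exI[of _ a] exI[of _ "\<phi> p"]) simp
      qed
    qed
    then obtain x y z where xyz: "\<And>K. K \<in> \<D> \<Longrightarrow> x K \<in> E \<inter> K \<and> y K \<in> E \<inter> K \<and> x K \<le> y K
        \<and> \<phi> ` (E \<inter> K) \<subseteq> {z K - 2 * \<bar>\<phi> (y K) - \<phi> (x K)\<bar> .. z K + 2 * \<bar>\<phi> (y K) - \<phi> (x K)\<bar>}"
      by metis
    define J where "J K = {z K - 2 * \<bar>\<phi> (y K) - \<phi> (x K)\<bar> .. z K + 2 * \<bar>\<phi> (y K) - \<phi> (x K)\<bar>}" for K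
    have JM: "J K \<in> lmeasurable" for K by (simp add: J_def)
    have bound: "measure lebesgue (\<Union>K\<in>F. J K) \<le> \<epsilon>" if F: "F \<subseteq> \<D>" "finite F" for F
    proof -
      define F' where "F' = {K\<in>F. x K < y K}"
      have F': "finite F'" "F' \<subseteq> \<D>" "F' \<subseteq> F" using F by (auto simp: F'_def)
      have xy: "x K \<in> E \<inter> K \<and> y K \<in> E \<inter> K \<and> x K < y K" if "K \<in> F'" for K
        using that xyz F by (auto simp: F'_def)
      have sub: "{x K<..<y K} \<subseteq> interior K" if "K \<in> F'" for K
      proof -
        obtain p q where "K = cbox p q" using \<D>(2)[of K] F' \<open>K \<in> F'\<close> by blast
        then show ?thesis using xy[OF that] by (intro open_interval_subset_interior) auto
      qed
      have pw: "pairwise (\<lambda>i j. {x i<..<y i} \<inter> {x j<..<y j} = {}) F'"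
      proof (rule pairwiseI)
        fix K L assume KL: "K \<in> F'" "L \<in> F'" "K \<noteq> L"
        then have "interior K \<inter> interior L = {}" using \<D>(3) F' by (auto simp: pairwise_def)
        then show "{x K<..<y K} \<inter> {x L<..<y L} = {}" using sub[OF KL(1)] sub[OF KL(2)] by blast
      qed
      have "measure lebesgue (\<Union>K\<in>F. J K) \<le> (\<Sum>K\<in>F. measure lebesgue (J K))"
        by (rule measure_UNION_le[OF F(2)]) (use JM in blast)
      also have "\<dots> = 4 * (\<Sum>K\<in>F. \<bar>\<phi> (y K) - \<phi> (x K)\<bar>)"
        by (simp add: J_def sum_distrib_left)
      also have "(\<Sum>K\<in>F. \<bar>\<phi> (y K) - \<phi> (x K)\<bar>) = (\<Sum>K\<in>F'. \<bar>\<phi> (y K) - \<phi> (x K)\<bar>)"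
        by (rule sum.mono_neutral_right[OF F(2) F'(3)]) (use F xyz in \<open>fastforce simp: F'_def\<close>)
      also have "(\<Sum>K\<in>F'. \<bar>\<phi> (y K) - \<phi> (x K)\<bar>) < \<epsilon>/4"
        by (rule varies_less_finite[OF ACd F'(1) _ pw len[OF F'(1,2)]]) (use xy in auto)
      finally show ?thesis by simp
    qed
    have "\<phi> ` E \<subseteq> (\<Union>K\<in>\<D>. J K)"
    proof (rule image_subsetI)
      fix t assume "t \<in> E"
      then obtain K where K: "K \<in> \<D>" "t \<in> E \<inter> K" using \<D>(5) by auto
      then show "\<phi> t \<in> (\<Union>K\<in>\<D>. J K)" using xyz[OF K(1)] unfolding J_def by blast
    qed
    moreover have "(\<Union>K\<in>\<D>. J K) \<in> lmeasurable" "measure lebesgue (\<Union>K\<in>\<D>. J K) \<le> \<epsilon>"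
      using fmeasurable_UN_bound[OF \<D>(1) JM bound] measure_UN_bound[OF \<D>(1) JM bound] by auto
    ultimately show "\<exists>T. \<phi> ` E \<subseteq> T \<and> T \<in> lmeasurable \<and> measure lebesgue T \<le> \<epsilon>" by blast
  qed
  define En where "En n = E \<inter> {- real (Suc n) .. real (Suc n)}" for n
  have "E = (\<Union>n. En n)"
  proof -
    have "\<exists>n. x \<in> En n" if "x \<in> E" for x
    proof -
      obtain n where "\<bar>x\<bar> \<le> real n" using real_arch_simple by blast
      then show ?thesis using that by (intro exI[of _ n]) (auto simp: En_def)
    qed
    then show ?thesis by (auto simp: En_def)
  qed
  then have "\<phi> ` E = (\<Union>n. \<phi> ` En n)" by (metis image_UN)
  moreover have "negligible (\<phi> ` En n)" for n
    by (rule bdd[of _ "- real (Suc n)" "real (Suc n)"])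
      (auto simp: En_def intro: AC_on_subset[OF AC] negligible_subset[OF E])
  ultimately show ?thesis by (metis negligible_Union_nat)
qed

text \<open>
  The pieces on which \<open>\<phi>\<close> and \<open>\<psi>\<close> are absolutely continuous intersect in countably many sets, on
  each of which the difference is absolutely continuous. The linear term is what turns a
  nonpositive derivative into a strictly negative one later on.
\<close>

lemma ACG_on_diff_linear_negligible_image:
  assumes "ACG_on S \<phi>" "ACG_on S \<psi>" and E: "negligible E" "E \<subseteq> S"
  shows "negligible ((\<lambda>t. \<phi> t - \<psi> t - k * t) ` E)"
proof -
  obtain A :: "nat \<Rightarrow> real set" where A: "S = (\<Union>n. A n)" "\<And>n. AC_on (A n) \<phi>"
    using assms(1) unfolding ACG_on_def by auto
  obtain B :: "nat \<Rightarrow> real set" where B: "S = (\<Union>n. B n)" "\<And>n. AC_on (B n) \<psi>"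
    using assms(2) unfolding ACG_on_def by auto
  let ?h = "\<lambda>t. \<phi> t - \<psi> t - k * t"
  have neg: "negligible (?h ` (E \<inter> A m \<inter> B n))" for m n
  proof (rule AC_on_negligible_image)
    show "AC_on (E \<inter> A m \<inter> B n) ?h"
      by (intro AC_on_diff AC_on_linear AC_on_subset[OF A(2)[of m]] AC_on_subset[OF B(2)[of n]]) auto
  qed (use E in \<open>auto intro: negligible_subset\<close>)
  have "?h ` E \<subseteq> (\<Union>m. \<Union>n. ?h ` (E \<inter> A m \<inter> B n))"
  proof (rule image_subsetI)
    fix t assume t: "t \<in> E"
    then have "t \<in> (\<Union>n. A n)" "t \<in> (\<Union>n. B n)" using A(1) B(1) E(2) by auto
    then obtain m n where "t \<in> A m" "t \<in> B n" by blast
    then have "?h t \<in> ?h ` (E \<inter> A m \<inter> B n)" using t by auto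
    then show "?h t \<in> (\<Union>m. \<Union>n. ?h ` (E \<inter> A m \<inter> B n))" by blast
  qed
  moreover have "negligible (\<Union>m. \<Union>n. ?h ` (E \<inter> A m \<inter> B n))"
    by (intro negligible_Union_nat neg)
  ultimately show ?thesis by (rule negligible_subset[rotated])
qed


section \<open>Ekeland's variational principle\<close>

text \<open>
  The sets \<open>T x = {y \<in> W. F y + e * dist x y \<le> F x}\<close> are closed, contain \<open>x\<close> and shrink when \<open>x\<close> is
  replaced by one of their elements. Repeatedly passing to an almost-minimiser of \<open>F\<close> on the
  current set forces the diameters to zero, and the common point \<open>x\<close> of all the sets satisfies
  \<open>T x = {x}\<close>, which is the claim.
\<close>

theorem ekeland_variational_principle:
  fixes F :: "'a::complete_space \<Rightarrow> real"
  assumes W: "closed W" and cont: "continuous_on W F" and bdd: "\<And>y. y \<in> W \<Longrightarrow> m \<le> F y"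
    and c: "c \<in> W" and e: "e > 0"
  obtains x where "x \<in> W" "F x + e * dist c x \<le> F c" "\<And>y. y \<in> W \<Longrightarrow> F x \<le> F y + e * dist x y"
proof -
  define T where "T x = {y\<in>W. F y + e * dist x y \<le> F x}" for x
  have refl: "x \<in> T x" if "x \<in> W" for x using that by (simp add: T_def)
  have nested: "T y \<subseteq> T x" if "y \<in> T x" for x y
  proof
    fix z assume z: "z \<in> T y"
    have "e * dist x z \<le> e * dist x y + e * dist y z"
      using mult_left_mono[OF dist_triangle[of x z y], of e] e by (simp add: algebra_simps)
    then show "z \<in> T x" using that z by (auto simp: T_def)
  qed
  have closed: "closed (T x)" for x
  proof -
    have "continuous_on W (\<lambda>y. F y + e * dist x y)" by (intro continuous_intros cont)
    then have "closed (W \<inter> (\<lambda>y. F y + e * dist x y) -` {..F x})"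
      by (rule continuous_closed_preimage[OF _ W closed_atMost])
    moreover have "T x = W \<inter> (\<lambda>y. F y + e * dist x y) -` {..F x}" by (auto simp: T_def)
    ultimately show ?thesis by simp
  qed
  have greedy: "\<exists>y. y \<in> T x \<and> (\<forall>z\<in>T x. F y \<le> F z + (1/2)^n)" if "x \<in> W" for x and n :: nat
  proof -
    have ne: "T x \<noteq> {}" using refl[OF that] by blast
    have below: "bdd_below (F ` T x)" using bdd by (auto simp: T_def intro!: bdd_belowI[of _ m])
    have "Inf (F ` T x) < Inf (F ` T x) + (1/2)^n" by simp
    then obtain y where y: "y \<in> T x" "F y < Inf (F ` T x) + (1/2)^n"
      unfolding cINF_less_iff[OF ne below] by blast
    have "F y \<le> F z + (1/2)^n" if "z \<in> T x" for z
      using cINF_lower[OF below that] y(2) by linarith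
    then show ?thesis using y(1) by blast
  qed
  define N where "N n x = (SOME y. y \<in> T x \<and> (\<forall>z\<in>T x. F y \<le> F z + (1/2)^n))" for n :: nat and x
  have N: "N n x \<in> T x \<and> (\<forall>z\<in>T x. F (N n x) \<le> F z + (1/2)^n)" if "x \<in> W" for n x
    unfolding N_def by (rule someI_ex[OF greedy[OF that]])
  define X where "X = rec_nat c N"
  have X0: "X 0 = c" and XS: "X (Suc n) = N n (X n)" for n by (simp_all add: X_def)
  have XW: "X n \<in> W" for n
    by (induction n) (use c N XS X0 in \<open>auto simp: T_def\<close>)
  have step: "X (Suc n) \<in> T (X n)" "z \<in> T (X n) \<Longrightarrow> F (X (Suc n)) \<le> F z + (1/2)^n" for n z
    using N[OF XW[of n], of n] by (auto simp: XS)
  have anti: "T (X n) \<subseteq> T (X m)" if "m \<le> n" for m n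
    using that by (rule lift_Suc_antimono_le[of "\<lambda>n. T (X n)", rotated]) (rule nested[OF step(1)])
  have small: "e * dist (X (Suc n)) y \<le> (1/2)^n" if "y \<in> T (X (Suc n))" for n y
  proof -
    have "y \<in> T (X n)" using anti[of n "Suc n"] that by auto
    from step(2)[OF this] show ?thesis using that by (simp add: T_def)
  qed
  have diam: "\<exists>n. \<forall>x\<in>T (X n). \<forall>y\<in>T (X n). dist x y < \<epsilon>" if "\<epsilon> > 0" for \<epsilon>
  proof -
    obtain n where n: "(1/2)^n < e * \<epsilon> / 2"
      using real_arch_pow_inv[of "e * \<epsilon> / 2" "1/2"] e \<open>\<epsilon> > 0\<close> by auto
    have "dist (X (Suc n)) y < \<epsilon> / 2" if "y \<in> T (X (Suc n))" for y
    proof -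
      have "e * dist (X (Suc n)) y < e * (\<epsilon>/2)" using small[OF that] n by simp
      then show ?thesis using e by simp
    qed
    then show ?thesis
      by (intro exI[of _ "Suc n"] ballI) (rule dist_triangle_half_r[of "X (Suc n)"])
  qed
  obtain x where x: "\<And>n. x \<in> T (X n)"
  proof (rule decreasing_closed_nest[of "\<lambda>n. T (X n)"])
    show "T (X n) \<noteq> {}" for n using refl[OF XW] by blast
  qed (use closed anti diam in auto)
  show thesis
  proof (rule that)
    show "x \<in> W" using x[of 0] by (simp add: T_def)
    show "F x + e * dist c x \<le> F c" using x[of 0] by (simp add: T_def X0)
    fix y assume y: "y \<in> W"
    show "F x \<le> F y + e * dist x y"
    proof (rule ccontr)
      assume "\<not> F x \<le> F y + e * dist x y"
      then have yT: "y \<in> T x" and ne: "y \<noteq> x" using y by (auto simp: T_def)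
      have "y \<in> T (X n)" for n using nested[OF x] yT by blast
      then have "dist x y < dist x y"
        using diam[of "dist x y"] x ne by auto
      then show False by simp
    qed
  qed
qed


section \<open>Subderivatives of real-valued functions\<close>

lemma isCont_tendsto_nhds: "isCont f x \<Longrightarrow> (f \<longlongrightarrow> f x) (nhds x)"
  by (simp add: isCont_def tendsto_at_iff_tendsto_nhds)

lemma tendsto_along_ray:
  fixes x u :: "'a::real_normed_vector"
  shows "((\<lambda>t. x + t *\<^sub>R u) \<longlongrightarrow> x) (at_right (0::real))"
proof -
  have "isCont (\<lambda>t. x + t *\<^sub>R u) 0" by (intro continuous_intros)
  then show ?thesis unfolding isCont_def by (auto intro: tendsto_within_subset)
qed

text \<open>
  In the definition of the upper subderivative the infimum runs over all directions near \<open>v x\<close>, so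
  at a point \<open>y\<close> near \<open>x\<close> the direction \<open>v y\<close> of a continuous field may be used instead
  of \<open>v x\<close>. This freedom is used for both functions below.
\<close>

lemma upper_subderivative_extend_le:
  fixes \<phi> :: "'a::real_normed_vector \<Rightarrow> real"
  assumes G: "open G" "x \<in> G" and v: "isCont v x" and r: "r > 0"
    and quot: "\<And>t y. \<lbrakk>0 < t; t < r; y \<in> ball x r\<rbrakk> \<Longrightarrow> \<phi> (y + t *\<^sub>R v y) - \<phi> y \<le> M * t"
  shows "upper_subderivative (extend G \<phi>) x (v x) \<le> ereal M"
proof -
  let ?h = "extend G \<phi>"
  have xd: "x \<in> edom ?h" using G by (simp add: edom_def extend_def)
  have "Limsup (at_right (0::real) \<times>\<^sub>F filtercomap (\<lambda>x. (x, ?h x)) (nhds (x, ?h x)))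
          (\<lambda>(t, y). INF u'\<in>ball (v x) \<delta>. (?h (y + t *\<^sub>R u') - ?h y) / ereal t) \<le> ereal M"
    if \<delta>: "\<delta> > 0" for \<delta>
  proof (rule Limsup_bounded)
    obtain \<rho> where \<rho>: "\<rho> > 0" "ball x \<rho> \<subseteq> G" using G open_contains_ball by blast
    have tend: "((\<lambda>y. v y) \<longlongrightarrow> v x) (nhds x)" using v by (simp add: continuous_at_imp_continuous_at_within isCont_def tendsto_at_iff_tendsto_nhds)
    have ev_v: "\<forall>\<^sub>F y in nhds x. v y \<in> ball (v x) (min \<delta> 1)"
      using tend topological_tendstoD[OF tend, of "ball (v x) (min \<delta> 1)"] \<delta> by auto
    have ev_x: "\<forall>\<^sub>F y in nhds x. y \<in> ball x (min r (\<rho>/2))"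
      using r \<rho> eventually_nhds_in_open[of "ball x (min r (\<rho>/2))" x] by auto
    define s where "s = min r (\<rho> / 2 / (norm (v x) + 1))"
    have s: "s > 0" using r \<rho> by (auto simp: s_def intro!: divide_pos_pos add_nonneg_pos)
    have ev_t: "\<forall>\<^sub>F t in at_right (0::real). t \<in> {0<..<s}"
      by (rule eventually_at_right_real[OF s])
    have ev_y: "\<forall>\<^sub>F y in filtercomap (\<lambda>x. (x, ?h x)) (nhds (x, ?h x)).
        v y \<in> ball (v x) (min \<delta> 1) \<and> y \<in> ball x (min r (\<rho>/2))"
    proof -
      have "filterlim (\<lambda>y. (y, ?h y)) (nhds (x, ?h x)) (filtercomap (\<lambda>x. (x, ?h x)) (nhds (x, ?h x)))"
        by (rule filterlim_filtercomap)
      from tendsto_fst[OF this] have "filterlim (\<lambda>y. y) (nhds x) (filtercomap (\<lambda>x. (x, ?h x)) (nhds (x, ?h x)))"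
        by simp
      from eventually_compose_filterlim[OF eventually_conj[OF ev_v ev_x] this] show ?thesis .
    qed
    show "\<forall>\<^sub>F p in at_right (0::real) \<times>\<^sub>F filtercomap (\<lambda>x. (x, ?h x)) (nhds (x, ?h x)).
        (case p of (t, y) \<Rightarrow> INF u'\<in>ball (v x) \<delta>. (?h (y + t *\<^sub>R u') - ?h y) / ereal t) \<le> ereal M"
      unfolding eventually_prod_filter prod.case
    proof (intro exI conjI allI impI, rule ev_t, rule ev_y, clarify)
      fix t y assume t: "t \<in> {0<..<s}" and vy: "v y \<in> ball (v x) (min \<delta> 1)" and y: "y \<in> ball x (min r (\<rho>/2))"
      have "norm (v y) \<le> norm (v x) + 1"
        using vy norm_triangle_ineq2[of "v y" "v x"] by (auto simp: dist_norm norm_minus_commute)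
      then have "norm (t *\<^sub>R v y) \<le> t * (norm (v x) + 1)" using t by (simp add: mult_left_mono)
      also have "\<dots> \<le> s * (norm (v x) + 1)" using t by (intro mult_right_mono) auto
      also have "\<dots> \<le> \<rho>/2 / (norm (v x) + 1) * (norm (v x) + 1)"
        by (intro mult_right_mono) (auto simp: s_def)
      also have "\<dots> = \<rho>/2"
      proof -
        have "norm (v x) + 1 \<noteq> 0" using norm_ge_zero[of "v x"] by linarith
        moreover have "a / b * b = a" if "b \<noteq> 0" for a b :: real using that by simp
        ultimately show ?thesis by blast
      qed
      finally have "dist x (y + t *\<^sub>R v y) < \<rho>"
        using y norm_triangle_ineq[of "y - x" "t *\<^sub>R v y"] 
        by (auto simp: dist_norm norm_minus_commute algebra_simps)
      then have inG: "y + t *\<^sub>R v y \<in> G" "y \<in> G" using \<rho> y by auto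
      have "(INF u'\<in>ball (v x) \<delta>. (?h (y + t *\<^sub>R u') - ?h y) / ereal t)
          \<le> (?h (y + t *\<^sub>R v y) - ?h y) / ereal t"
        by (rule INF_lower) (use vy in auto)
      also have "\<dots> = ereal ((\<phi> (y + t *\<^sub>R v y) - \<phi> y) / t)"
        using inG t by (simp add: extend_def)
      also have "\<dots> \<le> ereal M"
        using quot[of t y] t y by (simp add: s_def field_simps)
      finally show "(INF u'\<in>ball (v x) \<delta>. (?h (y + t *\<^sub>R u') - ?h y) / ereal t) \<le> ereal M" .
    qed
  qed
  then show ?thesis unfolding upper_subderivative_def using xd by (auto intro!: SUP_least)
qed

lemma radial_subderivative_extend_lessD:
  assumes "open G" "x \<in> G" and less: "radial_subderivative (extend G g) x u < ereal K" and b: "b > 0"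
  obtains t where "0 < t" "t < b" "x + t *\<^sub>R u \<in> G" "g (x + t *\<^sub>R u) - g x < K * t"
proof -
  have xd: "x \<in> edom (extend G g)" using assms by (simp add: edom_def extend_def)
  have fr: "\<exists>\<^sub>F t in at_right 0. (extend G g (x + t *\<^sub>R u) - extend G g x) / ereal t < ereal K"
  proof (rule ccontr)
    assume "\<not> ?thesis"
    then have "\<forall>\<^sub>F t in at_right 0. ereal K \<le> (extend G g (x + t *\<^sub>R u) - extend G g x) / ereal t"
      by (simp add: frequently_def not_less)
    then have "ereal K \<le> radial_subderivative (extend G g) x u"
      unfolding radial_subderivative_def using xd by (simp add: Liminf_bounded)
    then show False using less by simp
  qed
  have "isCont (\<lambda>t. x + t *\<^sub>R u) 0" by (intro continuous_intros)
  then have "((\<lambda>t. x + t *\<^sub>R u) \<longlongrightarrow> x) (at_right (0::real))"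
    unfolding isCont_def by (auto intro: tendsto_within_subset)
  then have "\<forall>\<^sub>F t in at_right (0::real). x + t *\<^sub>R u \<in> G"
    using assms topological_tendstoD by blast
  moreover have "\<forall>\<^sub>F t in at_right (0::real). t \<in> {0<..<b}" by (rule eventually_at_right_real[OF b])
  ultimately have "\<forall>\<^sub>F t in at_right (0::real). x + t *\<^sub>R u \<in> G \<and> t \<in> {0<..<b}" by eventually_elim simp
  from frequently_ex[OF frequently_eventually_conj[OF fr this]]
  obtain t where t: "x + t *\<^sub>R u \<in> G" "t \<in> {0<..<b}" "(extend G g (x + t *\<^sub>R u) - extend G g x) / ereal t < ereal K"
    by auto
  then show thesis
    using that[of t] assms(2) by (simp add: extend_def field_simps)
qed

lemma radial_subderivative_extend_greaterD:
  assumes "open G" "x \<in> G" and greater: "ereal K < radial_subderivative (extend G g) x u"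
  shows "\<forall>\<^sub>F t in at_right 0. 0 < t \<and> x + t *\<^sub>R u \<in> G \<and> K * t < g (x + t *\<^sub>R u) - g x"
proof -
  have "x \<in> edom (extend G g)" using assms by (simp add: edom_def extend_def)
  then have "ereal K < Liminf (at_right 0) (\<lambda>t. (extend G g (x + t *\<^sub>R u) - extend G g x) / ereal t)"
    using greater by (simp add: radial_subderivative_def)
  from less_LiminfD[OF this] topological_tendstoD[OF tendsto_along_ray assms(1,2), of u]
    eventually_at_right_less[of "0::real"]
  show ?thesis
  proof eventually_elim
    case (elim t)
    then have "K < (g (x + t *\<^sub>R u) - g x) / t" using assms(2) by (simp add: extend_def)
    then show ?case using elim by (simp add: field_simps)
  qed
qed


section \<open>Homing directions\<close>

text \<open>
  For \<open>\<alpha> > 0\<close> the direction is \<open>\<alpha>\<close> times the vector from \<open>x\<close> to \<open>xb + u/\<alpha>\<close>: moving along it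
  shortens it without turning it.
\<close>

lemma homing_direction_scale:
  fixes x :: "'a::real_vector"
  shows "u + \<alpha> *\<^sub>R (xb - (x + s *\<^sub>R (u + \<alpha> *\<^sub>R (xb - x)))) = (1 - \<alpha> * s) *\<^sub>R (u + \<alpha> *\<^sub>R (xb - x))"
  by (simp add: algebra_simps)

text \<open>
  A mean value inequality along the homing direction: on the line from \<open>y\<close> in the
  direction \<open>w y\<close>, the direction \<open>w z\<close> at any later point \<open>z\<close> is a positive multiple of \<open>w y\<close> with a
  factor near 1, so a bound on the radial subderivatives at all these points limits the growth of
  \<open>g\<close> along the whole line. A fixed direction in place of \<open>w\<close> would not match the direction that the
  bound refers to at \<open>z\<close>.
\<close>

lemma upper_subderivative_le_radial_bound:
  fixes g :: "'a::real_normed_vector \<Rightarrow> real"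
  assumes G: "open G" "continuous_on G g" and N: "open N" "N \<subseteq> G" and \<alpha>: "\<alpha> \<ge> 0"
    and rad: "\<And>y. y \<in> N \<Longrightarrow> radial_subderivative (extend G g) y (u + \<alpha> *\<^sub>R (xb - y)) < ereal M"
    and x: "x \<in> N" and \<eta>: "\<eta> > 0"
  shows "upper_subderivative (extend G g) x (u + \<alpha> *\<^sub>R (xb - x)) \<le> ereal (M + \<eta>)"
proof -
  define w where "w y = u + \<alpha> *\<^sub>R (xb - y)" for y
  have contw: "continuous_on UNIV w" unfolding w_def by (intro continuous_intros)
  have w0: "isCont w x" using contw by (simp add: continuous_on_eq_continuous_at)
  have "continuous_on UNIV (\<lambda>p. snd p + fst p *\<^sub>R w (snd p))"
    by (intro continuous_intros continuous_on_compose2[OF contw]) auto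
  then have "isCont (\<lambda>p. snd p + fst p *\<^sub>R w (snd p)) (0, x)"
    by (simp add: continuous_on_eq_continuous_at)
  from topological_tendstoD[OF isCont_tendsto_nhds[OF this] N(1)]
  have ev1: "\<forall>\<^sub>F p in nhds (0, x). snd p + fst p *\<^sub>R w (snd p) \<in> N"
    using x by simp
  have "isCont (\<lambda>s. (M + \<eta>) * (1 - \<alpha> * s)) (0::real)" by (intro continuous_intros)
  then have "\<forall>\<^sub>F s in nhds (0::real). M < (M + \<eta>) * (1 - \<alpha> * s)"
    using \<eta> by (intro order_tendstoD(1)[OF isCont_tendsto_nhds]) auto
  moreover have "isCont (\<lambda>s. 1 - \<alpha> * s) (0::real)" by (intro continuous_intros)
  then have "\<forall>\<^sub>F s in nhds (0::real). 0 < 1 - \<alpha> * s"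
    by (intro order_tendstoD(1)[OF isCont_tendsto_nhds]) auto
  ultimately have ev2: "\<forall>\<^sub>F s in nhds (0::real). M < (M + \<eta>) * (1 - \<alpha> * s) \<and> 0 < 1 - \<alpha> * s"
    by (rule eventually_conj)
  obtain r1 where r1: "r1 > 0" "\<And>p. dist p (0, x) < r1 \<Longrightarrow> snd p + fst p *\<^sub>R w (snd p) \<in> N"
    using ev1 unfolding eventually_nhds_metric by blast
  obtain r2 where r2: "r2 > 0" "\<And>s. dist s 0 < r2 \<Longrightarrow> M < (M + \<eta>) * (1 - \<alpha> * s) \<and> 0 < 1 - \<alpha> * s"
    using ev2 unfolding eventually_nhds_metric by blast
  define r where "r = min (r1/2) r2"
  have r: "r > 0" using r1 r2 by (simp add: r_def)
  have inN: "y + s *\<^sub>R w y \<in> N" if "0 \<le> s" "s < r" "y \<in> ball x r" for s y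
  proof -
    have "dist (s, y) (0, x) \<le> dist s 0 + dist y x"
      using sqrt_sum_squares_le_sum_abs[of s "dist y x"] by (simp add: dist_Pair_Pair)
    also have "\<dots> < r1" using that by (simp add: r_def dist_commute)
    finally show ?thesis using r1(2)[of "(s, y)"] by simp
  qed
  have "upper_subderivative (extend G g) x (w x) \<le> ereal (M + \<eta>)"
  proof (rule upper_subderivative_extend_le[OF G(1) _ w0 r])
    show "x \<in> G" using x N by auto
    fix t y assume t: "0 < t" "t < r" and y: "y \<in> ball x r"
    let ?h = "\<lambda>s. g (y + s *\<^sub>R w y) - (M + \<eta>) * s"
    have "?h t \<le> ?h 0"
    proof (rule growth_off_negligible_image[where N = "{}" and h = ?h and a = 0 and b = t])
      show "continuous_on {0..t} ?h"
        by (intro continuous_intros continuous_on_compose2[OF G(2)]) (use inN t y N in force)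
      fix s assume s: "0 \<le> s" "s < t"
      define z where "z = y + s *\<^sub>R w y"
      define \<kappa> where "\<kappa> = 1 - \<alpha> * s"
      have zN: "z \<in> N" unfolding z_def using inN s t y by auto
      have \<kappa>: "\<kappa> > 0" "M < (M + \<eta>) * \<kappa>" using r2(2)[of s] s t by (auto simp: \<kappa>_def r_def)
      have wz: "w z = \<kappa> *\<^sub>R w y" unfolding z_def \<kappa>_def w_def by (rule homing_direction_scale)
      have "radial_subderivative (extend G g) z (w z) < ereal ((M + \<eta>) * \<kappa>)"
        using rad[OF zN] \<kappa>(2) by (auto simp: w_def intro: order_less_trans)
      moreover have "(t - s) / \<kappa> > 0" using s \<kappa> by simp
      ultimately obtain \<tau> where \<tau>: "0 < \<tau>" "\<tau> < (t - s) / \<kappa>"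
          "g (z + \<tau> *\<^sub>R w z) - g z < (M + \<eta>) * \<kappa> * \<tau>"
        using radial_subderivative_extend_lessD[OF G(1)] zN N(2) by blast
      have "z + \<tau> *\<^sub>R w z = y + (s + \<kappa> * \<tau>) *\<^sub>R w y" unfolding wz unfolding z_def by (simp add: algebra_simps)
      then have "?h (s + \<kappa> * \<tau>) < ?h s" using \<tau>(3) by (simp add: z_def algebra_simps)
      moreover have "s < s + \<kappa> * \<tau>" "s + \<kappa> * \<tau> \<le> t" using \<tau> \<kappa> by (auto simp: field_simps)
      ultimately show "\<exists>s'>s. s' \<le> t \<and> ?h s' < ?h s" by blast
    qed (use t in auto)
    then show "g (y + t *\<^sub>R w y) - g y \<le> (M + \<eta>) * t" by simp
  qed
  then show ?thesis by (simp add: w_def)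
qed

text \<open>
  Replacing \<open>c\<close> by \<open>x\<close> in the homing direction changes the value of \<open>ys\<close> by
  \<open>\<alpha>\<close> times its value at \<open>x - c\<close>, and it is exactly the upper limit of these values that
  is controlled along a net defining a limiting subgradient. The sign \<open>\<alpha> \<ge> 0\<close> matters here.
\<close>

lemma limiting_subdifferential_homing_le:
  fixes h :: "'a::real_normed_vector \<Rightarrow> ereal"
  assumes xs: "xs \<in> limiting_subdifferential D h c" and N: "open N" "c \<in> N" and \<alpha>: "\<alpha> \<ge> 0"
    and bound: "\<And>x ys. \<lbrakk>x \<in> N; ys \<in> D h x\<rbrakk> \<Longrightarrow> blinfun_apply ys (u + \<alpha> *\<^sub>R (xb - x)) \<le> M"
  shows "blinfun_apply xs (u + \<alpha> *\<^sub>R (xb - c)) \<le> M"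
proof (rule field_le_epsilon)
  fix e :: real assume e: "e > 0"
  define \<eta> where "\<eta> = e / (\<alpha> + 1)"
  have \<eta>: "\<eta> > 0" "\<alpha> * \<eta> \<le> e" using e \<alpha> by (auto simp: \<eta>_def field_simps)
  obtain F :: "('a \<times> ('a \<Rightarrow>\<^sub>L real)) filter" where F: "F \<noteq> bot"
    and ev: "\<forall>\<^sub>F (x, ys) in F. ys \<in> D h x"
    and lim: "((\<lambda>(x, ys). (x, h x)) \<longlongrightarrow> (c, h c)) F"
    and weak: "\<And>v. ((\<lambda>(x, ys). blinfun_apply ys v) \<longlongrightarrow> blinfun_apply xs v) F"
    and sup: "Limsup F (\<lambda>(x, ys). ereal (blinfun_apply ys (x - c))) \<le> 0"
    using xs unfolding limiting_subdifferential_def by blast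
  have "((\<lambda>p. fst p) \<longlongrightarrow> c) F"
    using tendsto_fst[OF lim] by (simp add: case_prod_beta)
  then have evN: "\<forall>\<^sub>F p in F. fst p \<in> N" using N topological_tendstoD by blast
  have "Limsup F (\<lambda>(x, ys). ereal (blinfun_apply ys (x - c))) < ereal \<eta>"
    using sup \<eta>(1) by (simp add: order.strict_trans1)
  from Limsup_lessD[OF this] have ev\<eta>: "\<forall>\<^sub>F p in F. blinfun_apply (snd p) (fst p - c) < \<eta>"
    by (simp add: case_prod_beta)
  have "\<forall>\<^sub>F p in F. (\<lambda>(x, ys). blinfun_apply ys (u + \<alpha> *\<^sub>R (xb - c))) p \<le> M + e"
    using ev evN ev\<eta>
  proof eventually_elim
    case (elim p)
    have "blinfun_apply (snd p) (u + \<alpha> *\<^sub>R (xb - c))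
        = blinfun_apply (snd p) (u + \<alpha> *\<^sub>R (xb - fst p)) + \<alpha> * blinfun_apply (snd p) (fst p - c)"
      by (simp add: blinfun.add_right blinfun.diff_right blinfun.scaleR_right algebra_simps)
    also have "\<dots> \<le> M + \<alpha> * \<eta>"
      using elim bound[of "fst p" "snd p"] \<alpha> by (intro add_mono mult_left_mono) (auto simp: case_prod_beta)
    finally show ?case using \<eta>(2) by (simp add: case_prod_beta)
  qed
  then show "blinfun_apply xs (u + \<alpha> *\<^sub>R (xb - c)) \<le> M + e"
    by (rule tendsto_upperbound[OF weak _ F])
qed

text \<open>
  The sets generating directional convergence are unions of open balls around the points
  \<open>xb + t u\<close>, hence open. Openness makes a bound that holds along \<open>x \<rightarrow>\<^sub>u xb\<close> available in a full
  neighbourhood of every point \<open>xb + t u\<close> with small \<open>t > 0\<close>.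
\<close>

lemma directional_neighbourhood:
  fixes xb u :: "'a::real_normed_vector"
  assumes "\<forall>\<^sub>F x in at_direction xb u. P x"
  obtains N r where "open N" "r > 0" "\<And>t. \<lbrakk>0 < t; t < r\<rbrakk> \<Longrightarrow> xb + t *\<^sub>R u \<in> N" "\<And>x. x \<in> N \<Longrightarrow> P x"
proof -
  obtain Pt Pv where Pt: "eventually Pt (at_right (0::real))" and Pv: "eventually Pv (nhds u)"
    and P: "\<And>t v. Pt t \<Longrightarrow> Pv v \<Longrightarrow> P (xb + t *\<^sub>R v)"
    using assms unfolding at_direction_def eventually_filtermap eventually_prod_filter by auto
  obtain r where r: "r > 0" "\<And>t. 0 < t \<Longrightarrow> t < r \<Longrightarrow> Pt t"
    using Pt unfolding eventually_at_right_field by auto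
  obtain V where V: "open V" "u \<in> V" "\<And>v. v \<in> V \<Longrightarrow> Pv v"
    using Pv unfolding eventually_nhds by auto
  define N where "N = (\<Union>t\<in>{0<..<r}. (\<lambda>v. xb + t *\<^sub>R v) ` V)"
  show thesis
  proof (rule that[of N r])
    show "open N" unfolding N_def
    proof (intro open_UN ballI)
      fix t assume "t \<in> {0<..<r}"
      then have "open ((+) xb ` (\<lambda>v. t *\<^sub>R v) ` V)"
        by (intro open_translation open_scaling V) auto
      then show "open ((\<lambda>v. xb + t *\<^sub>R v) ` V)" by (simp add: image_image)
    qed
  qed (use r V P in \<open>auto simp: N_def\<close>)
qed


section \<open>Convex penalty functions\<close>

text \<open>
  A multiple of the distance to an endpoint of the segment, the near one for \<open>\<mu> \<le> 0\<close> and the far one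
  for \<open>\<mu> > 0\<close>. It stands in for a continuous linear functional with value \<open>- \<mu>\<close> at \<open>u\<close>: adding it to \<open>f\<close> subtracts
  the slope \<open>\<mu>\<close> along the segment.
\<close>

lemma affine_along_ray_convex_lipschitz:
  fixes xb u :: "'a::real_normed_vector"
  assumes u: "u \<noteq> 0"
  obtains \<theta> L where "convex_on UNIV \<theta>" "L-lipschitz_on UNIV \<theta>"
    "\<And>s. \<lbrakk>0 \<le> s; s \<le> T\<rbrakk> \<Longrightarrow> \<theta> (xb + s *\<^sub>R u) = \<theta> xb - \<mu> * s"
proof -
  define q where "q = (if \<mu> \<le> 0 then xb else xb + T *\<^sub>R u)"
  define \<kappa> where "\<kappa> = \<bar>\<mu>\<bar> / norm u"
  have \<kappa>: "\<kappa> \<ge> 0" "\<kappa> * norm u = \<bar>\<mu>\<bar>" using u by (auto simp: \<kappa>_def)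
  show thesis
  proof (rule that)
    show "convex_on UNIV (\<lambda>x. \<kappa> * dist q x)" using \<kappa>(1) by (intro convex_on_cmul convex_on_dist) auto
    have "1-lipschitz_on UNIV (dist q)"
      by (rule lipschitz_onI) (metis abs_dist_diff_le dist_commute dist_real_def mult_1, simp)
    then show "(\<kappa> * 1)-lipschitz_on UNIV (\<lambda>x. \<kappa> * dist q x)"
      using \<kappa>(1) by (rule lipschitz_on_cmult_real_nonneg)
    fix s assume s: "0 \<le> s" "s \<le> T"
    show "\<kappa> * dist q (xb + s *\<^sub>R u) = \<kappa> * dist q xb - \<mu> * s"
    proof (cases "\<mu> \<le> 0")
      case True
      have "\<kappa> * dist q (xb + s *\<^sub>R u) = s * (\<kappa> * norm u)"
        using True s by (simp add: q_def dist_norm)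
      then show ?thesis using True \<kappa>(2) by (simp add: q_def)
    next
      case False
      have "q - (xb + s *\<^sub>R u) = (T - s) *\<^sub>R u" "q - xb = T *\<^sub>R u"
        using False by (simp_all add: q_def algebra_simps)
      then have "dist q (xb + s *\<^sub>R u) = (T - s) * norm u" "dist q xb = T * norm u"
        using s by (simp_all add: dist_norm)
      then have "\<kappa> * dist q (xb + s *\<^sub>R u) = (T - s) * (\<kappa> * norm u)" "\<kappa> * dist q xb = T * (\<kappa> * norm u)"
        by simp_all
      then show ?thesis using False \<kappa>(2) by (simp add: algebra_simps)
    qed
  qed
qed

lemma convex_on_infdist:
  fixes S :: "'a::real_normed_vector set"
  assumes S: "convex S" "S \<noteq> {}"
  shows "convex_on UNIV (\<lambda>x. infdist x S)"
proof (rule convex_onI)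
  fix t :: real and x y :: 'a
  assume t: "0 < t" "t < 1"
  show "infdist ((1 - t) *\<^sub>R x + t *\<^sub>R y) S \<le> (1 - t) * infdist x S + t * infdist y S"
  proof (rule field_le_epsilon)
    fix e :: real assume e: "e > 0"
    have near: "\<exists>a\<in>S. dist z a < infdist z S + e" for z
    proof -
      have "bdd_below (dist z ` S)" by (auto intro!: bdd_belowI[of _ 0])
      moreover have "(INF a\<in>S. dist z a) < infdist z S + e" using e infdist_notempty[OF S(2)] by simp
      ultimately show ?thesis using cINF_less_iff[OF S(2)] by blast
    qed
    obtain a where a: "a \<in> S" "dist x a < infdist x S + e" using near by blast
    obtain b where b: "b \<in> S" "dist y b < infdist y S + e" using near by blast
    have "(1 - t) *\<^sub>R a + t *\<^sub>R b \<in> S" using S(1) a b t by (simp add: convex_alt)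
    then have "infdist ((1 - t) *\<^sub>R x + t *\<^sub>R y) S \<le> dist ((1 - t) *\<^sub>R x + t *\<^sub>R y) ((1 - t) *\<^sub>R a + t *\<^sub>R b)"
      by (rule infdist_le)
    also have "\<dots> = norm ((1 - t) *\<^sub>R (x - a) + t *\<^sub>R (y - b))"
      by (simp add: dist_norm algebra_simps)
    also have "\<dots> \<le> (1 - t) * dist x a + t * dist y b"
      using norm_triangle_ineq[of "(1 - t) *\<^sub>R (x - a)" "t *\<^sub>R (y - b)"] t by (simp add: dist_norm)
    also have "\<dots> \<le> (1 - t) * (infdist x S + e) + t * (infdist y S + e)"
      using a b t by (intro add_mono mult_left_mono) auto
    also have "\<dots> = (1 - t) * infdist x S + t * infdist y S + e" by (simp add: algebra_simps)
    finally show "infdist ((1 - t) *\<^sub>R x + t *\<^sub>R y) S \<le> (1 - t) * infdist x S + t * infdist y S + e" .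
  qed
qed simp

text \<open>
  Difference quotients of a convex function increase with the step, so a bound at the single step
  \<open>\<tau>0\<close>, which is stable under small changes of the point by continuity, covers all shorter steps.
\<close>

lemma convex_difference_quotient_near:
  fixes \<theta> :: "'a::real_normed_vector \<Rightarrow> real"
  assumes conv: "convex_on UNIV \<theta>" and cont: "continuous_on UNIV \<theta>" "continuous_on UNIV w"
    and \<tau>0: "\<tau>0 > 0" and less: "\<theta> (c + \<tau>0 *\<^sub>R w c) - \<theta> c < M * \<tau>0"
  shows "\<forall>\<^sub>F x in nhds c. \<forall>\<tau>. 0 < \<tau> \<longrightarrow> \<tau> \<le> \<tau>0 \<longrightarrow> \<theta> (x + \<tau> *\<^sub>R w x) - \<theta> x \<le> M * \<tau>"
proof -
  have "continuous_on UNIV (\<lambda>x. \<theta> (x + \<tau>0 *\<^sub>R w x) - \<theta> x)"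
    by (intro continuous_intros cont continuous_on_compose2[OF cont(1)]) auto
  then have "isCont (\<lambda>x. \<theta> (x + \<tau>0 *\<^sub>R w x) - \<theta> x) c"
    by (simp add: continuous_on_eq_continuous_at)
  from order_tendstoD(2)[OF isCont_tendsto_nhds[OF this] less]
  show ?thesis
  proof (rule eventually_mono, intro allI impI)
    fix x \<tau> assume H: "\<theta> (x + \<tau>0 *\<^sub>R w x) - \<theta> x < M * \<tau>0" "0 < \<tau>" "\<tau> \<le> \<tau>0"
    define t where "t = \<tau> / \<tau>0"
    have t: "0 \<le> t" "t \<le> 1" "t * \<tau>0 = \<tau>" using H \<tau>0 by (auto simp: t_def)
    have "\<theta> ((1 - t) *\<^sub>R x + t *\<^sub>R (x + \<tau>0 *\<^sub>R w x)) \<le> (1 - t) * \<theta> x + t * \<theta> (x + \<tau>0 *\<^sub>R w x)"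
      using convex_onD[OF conv t(1,2)] by simp
    moreover have "(1 - t) *\<^sub>R x + t *\<^sub>R (x + \<tau>0 *\<^sub>R w x) = x + \<tau> *\<^sub>R w x"
      unfolding t(3)[symmetric] by (simp add: algebra_simps)
    ultimately have "\<theta> (x + \<tau> *\<^sub>R w x) \<le> (1 - t) * \<theta> x + t * \<theta> (x + \<tau>0 *\<^sub>R w x)"
      by (simp only:)
    then have "\<theta> (x + \<tau> *\<^sub>R w x) - \<theta> x \<le> t * (\<theta> (x + \<tau>0 *\<^sub>R w x) - \<theta> x)"
      by (simp add: algebra_simps)
    also have "\<dots> \<le> t * (M * \<tau>0)" using H(1) t(1) by (intro mult_left_mono) auto
    also have "\<dots> = M * \<tau>" by (simp flip: t(3))
    finally show "\<theta> (x + \<tau> *\<^sub>R w x) - \<theta> x \<le> M * \<tau>" .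
  qed
qed

text \<open>
  If \<open>p\<close> is the point of the segment nearest to \<open>x\<close>, moving both \<open>x\<close> and \<open>p\<close> by \<open>\<tau>\<close> times their
  homing directions multiplies \<open>x - p\<close> by \<open>1 - \<tau> \<alpha>\<close>, and \<open>p\<close> stays on the segment as long as it is
  not too close to the far endpoint. The radius \<open>\<rho>\<close> depends only on the segment: below, the distance
  is multiplied by a large penalty constant, and no error term could be afforded.
\<close>

lemma infdist_segment_homing_le:
  fixes xb u :: "'a::real_normed_vector"
  assumes u: "u \<noteq> 0" and \<alpha>: "\<alpha> \<ge> 0" "\<alpha> * b \<le> 1" and s: "0 \<le> a" "a \<le> sc" "sc < b"
  defines "S \<equiv> (\<lambda>s. xb + s *\<^sub>R u) ` {a..b}"
  obtains \<rho> where "\<rho> > 0"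
    "\<And>x \<tau>. \<lbrakk>x \<in> ball (xb + sc *\<^sub>R u) \<rho>; 0 < \<tau>; \<tau> \<le> \<rho>\<rbrakk>
      \<Longrightarrow> infdist (x + \<tau> *\<^sub>R (u + \<alpha> *\<^sub>R (xb - x))) S \<le> infdist x S"
proof
  define \<rho> where "\<rho> = Min {(b - sc) / 2, (b - sc) * norm u / 4, 1 / (\<alpha> + 1)}"
  have le: "\<rho> \<le> (b - sc) / 2" "\<rho> \<le> (b - sc) * norm u / 4" "\<rho> \<le> 1 / (\<alpha> + 1)"
    unfolding \<rho>_def by (rule Min_le; simp)+
  show "\<rho> > 0" using u s \<alpha> by (simp add: \<rho>_def)
  fix x \<tau> assume x: "x \<in> ball (xb + sc *\<^sub>R u) \<rho>" and \<tau>: "0 < \<tau>" "\<tau> \<le> \<rho>"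
  have "compact S" unfolding S_def by (intro compact_continuous_image continuous_intros) auto
  moreover have ne: "S \<noteq> {}" using s by (simp add: S_def)
  ultimately obtain p where p: "p \<in> S" "\<And>z. z \<in> S \<Longrightarrow> dist x p \<le> dist x z"
    using continuous_attains_inf[of S "dist x"] continuous_on_dist[OF continuous_on_const continuous_on_id]
    by blast
  have inf: "infdist x S = dist x p"
    unfolding infdist_notempty[OF ne] by (rule cInf_eq_minimum) (use p in auto)
  obtain s' where s': "a \<le> s'" "s' \<le> b" "p = xb + s' *\<^sub>R u" using p(1) by (auto simp: S_def)
  have "xb + sc *\<^sub>R u \<in> S" using s by (auto simp: S_def)
  then have "dist x p < \<rho>" using p(2)[of "xb + sc *\<^sub>R u"] x by (simp add: dist_commute)
  then have "dist p (xb + sc *\<^sub>R u) < 2 * \<rho>"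
    using x dist_triangle[of p "xb + sc *\<^sub>R u" x] by (simp add: dist_commute)
  also have "\<dots> \<le> (b - sc) / 2 * norm u" using le(2) by simp
  also have "dist p (xb + sc *\<^sub>R u) = \<bar>s' - sc\<bar> * norm u"
    by (simp add: s' dist_norm flip: scaleR_diff_left)
  finally have "\<bar>s' - sc\<bar> < (b - sc) / 2" using u by simp
  then have "s' - sc < (b - sc) / 2" by (rule le_less_trans[OF abs_ge_self])
  moreover have "\<tau> \<le> (b - sc) / 2" using \<tau>(2) le(1) by (rule order_trans)
  ultimately have s'b: "s' + \<tau> \<le> b" by (simp add: field_simps)
  have as: "0 \<le> \<alpha> * s'" "\<alpha> * s' \<le> 1"
    using \<alpha> s s' mult_left_mono[of s' b \<alpha>] by auto
  have \<tau>1: "\<tau> * (1 - \<alpha> * s') \<le> \<tau>" "0 \<le> \<tau> * (1 - \<alpha> * s')"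
    using as \<tau> by (auto simp: mult_le_cancel_left1)
  define p' where "p' = xb + (s' + \<tau> * (1 - \<alpha> * s')) *\<^sub>R u"
  have "p' \<in> S" unfolding S_def p'_def by (rule imageI) (use \<tau>1 s' s'b in auto)
  have "\<tau> * \<alpha> \<le> 1 / (\<alpha> + 1) * \<alpha>" using \<tau> le(3) \<alpha> by (intro mult_right_mono) auto
  also have "\<dots> \<le> 1" using \<alpha> by (simp add: field_simps)
  finally have \<tau>\<alpha>: "\<tau> * \<alpha> \<le> 1" .
  have "infdist (x + \<tau> *\<^sub>R (u + \<alpha> *\<^sub>R (xb - x))) S \<le> dist (x + \<tau> *\<^sub>R (u + \<alpha> *\<^sub>R (xb - x))) p'"
    by (rule infdist_le[OF \<open>p' \<in> S\<close>])
  also have "\<dots> = norm ((1 - \<tau> * \<alpha>) *\<^sub>R (x - p))"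
    unfolding dist_norm p'_def s'(3) by (simp add: algebra_simps)
  also have "\<dots> \<le> dist x p"
    using \<tau>\<alpha> \<tau> \<alpha> by (auto simp: dist_norm intro!: mult_left_le_one_le)
  finally show "infdist (x + \<tau> *\<^sub>R (u + \<alpha> *\<^sub>R (xb - x))) S \<le> infdist x S" by (simp add: inf)
qed


section \<open>Limiting subgradients near a segment\<close>

lemma extend_in_extended_functions: "extend G f \<in> extended_functions G"
  by (simp add: extend_def extended_functions_def)

lemma lsc_on_extend:
  assumes "continuous_on G f"
  shows "lsc_on G (extend G f)"
  unfolding lsc_on_def
proof
  fix x assume x: "x \<in> G"
  show "extend G f x \<le> Liminf (at x within G) (extend G f)"
  proof (cases "at x within G = bot")
    case False
    have "((\<lambda>y. ereal (f y)) \<longlongrightarrow> ereal (f x)) (at x within G)"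
      using assms x by (auto simp: continuous_on_def)
    then have "(extend G f \<longlongrightarrow> ereal (f x)) (at x within G)"
      by (rule Lim_transform_eventually) (auto simp: eventually_at_filter extend_def)
    from lim_imp_Liminf[OF False this] show ?thesis using x by (simp add: extend_def)
  qed simp
qed

lemma separation_principle_real:
  fixes f :: "'a::real_normed_vector \<Rightarrow> real"
  assumes D: "is_subdifferential G D" and G: "open G" "convex G" and f: "continuous_on G f"
    and conv: "convex_on UNIV \<phi>" and lip: "L-lipschitz_on UNIV \<phi>" and x: "x \<in> G"
    and min: "\<forall>\<^sub>F y in nhds x. f x + \<phi> x \<le> f y + \<phi> y"
  obtains xs ys where "xs \<in> limiting_subdifferential D (extend G f) x"
    "ys \<in> clarke_subdifferential (extend G \<phi>) x" "xs + ys = 0"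
proof -
  have "x \<in> edom (extend G f)" using x by (simp add: edom_def extend_def)
  moreover have "continuous_on G \<phi>"
    using lipschitz_on_continuous_on[OF lip] continuous_on_subset by blast
  moreover have "ereal_convex_on G (extend G \<phi>)"
    unfolding ereal_convex_on_def
  proof (intro ballI)
    fix p q and t :: real assume H: "p \<in> G" "q \<in> G" "t \<in> {0<..<1}"
    then have "(1 - t) *\<^sub>R p + t *\<^sub>R q \<in> G" using G(2) by (simp add: convex_alt)
    then show "extend G \<phi> ((1 - t) *\<^sub>R p + t *\<^sub>R q)
        \<le> ereal (1 - t) * extend G \<phi> p + ereal t * extend G \<phi> q"
      using H convex_onD[OF conv, of t p q] by (simp add: extend_def)
  qed
  moreover have "lipschitz_near (extend G \<phi>) x"
  proof -
    obtain e where e: "e > 0" "ball x e \<subseteq> G" using G x open_contains_ball by blast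
    have "L-lipschitz_on (ball x e) (\<lambda>y. real_of_ereal (extend G \<phi> y))"
      using e lip by (auto simp: lipschitz_on_def extend_def)
    then show ?thesis
      unfolding lipschitz_near_def using e by (intro exI[of _ e]) (auto simp: extend_def)
  qed
  moreover have "\<forall>\<^sub>F y in nhds x. extend G f x + extend G \<phi> x \<le> extend G f y + extend G \<phi> y"
    using min eventually_nhds_in_open[OF G(1) x]
    by eventually_elim (use x in \<open>simp add: extend_def\<close>)
  moreover have "separation_principle G D" using D by (simp add: is_subdifferential_def)
  ultimately have "\<exists>xs\<in>limiting_subdifferential D (extend G f) x. \<exists>ys\<in>D (extend G \<phi>) x. 0 = xs + ys"
    unfolding separation_principle_def
    using lsc_on_extend[OF f] lsc_on_extend[of G \<phi>] extend_in_extended_functions[of G f]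
      extend_in_extended_functions[of G \<phi>] by blast
  then obtain xs ys where "xs \<in> limiting_subdifferential D (extend G f) x"
      "ys \<in> D (extend G \<phi>) x" "xs + ys = 0"
    by (metis (no_types))
  moreover have "D (extend G \<phi>) x \<subseteq> clarke_subdifferential (extend G \<phi>) x"
    using D extend_in_extended_functions unfolding is_subdifferential_def by blast
  ultimately show thesis using that by blast
qed

text \<open>
  A weak form of the mean value theorem of Zagrodny, with the intermediate point located on the open
  ray from \<open>xb\<close>. The function \<open>\<psi>\<close>, which is \<open>f\<close> along the ray minus the slope \<open>\<mu>\<close>, exceeds its
  value at \<open>0\<close> at every small positive time. Starting the segment at a point slightly after \<open>xb\<close>
  instead of at \<open>xb\<close> keeps the minimiser \<open>c0\<close> on the open ray, where \<open>N\<close> is a full neighbourhood of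
  it; around \<open>xb\<close> itself \<open>N\<close> need not contain a ball.
\<close>

theorem separation_at_directional_point:
  fixes f :: "'a::banach \<Rightarrow> real"
  assumes sub: "is_subdifferential G D" and G: "open G" "convex G" and f: "continuous_on G f"
    and xb: "xb \<in> G" and u: "u \<noteq> 0" and \<alpha>: "\<alpha> \<ge> 0"
    and less: "ereal \<mu> < radial_subderivative (extend G f) xb u"
    and N: "open N" "r > 0" "\<And>t. \<lbrakk>0 < t; t < r\<rbrakk> \<Longrightarrow> xb + t *\<^sub>R u \<in> N" and \<epsilon>: "\<epsilon> > 0"
  obtains c xs where "c \<in> N" "xs \<in> limiting_subdifferential D (extend G f) c"
    "\<mu> - \<epsilon> < blinfun_apply xs (u + \<alpha> *\<^sub>R (xb - c))"
proof -
  define w where "w x = u + \<alpha> *\<^sub>R (xb - x)" for x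
  have contw: "continuous_on UNIV w" unfolding w_def by (intro continuous_intros)
  define \<psi> where "\<psi> s = f (xb + s *\<^sub>R u) - \<mu> * s" for s

  (* The length b is small enough for the ray to stay in G and N and for the factor 1 - \<alpha> s, by which
     the homing direction shrinks at time s, to change the slope \<mu> by no more than \<epsilon>/4. *)
  have "\<forall>\<^sub>F t in at_right (0::real). t \<in> {0<..<r}" by (rule eventually_at_right_real[OF N(2)])
  with radial_subderivative_extend_greaterD[OF G(1) xb less]
  have "\<forall>\<^sub>F t in at_right (0::real). xb + t *\<^sub>R u \<in> G \<inter> N \<and> f xb < \<psi> t"
    by eventually_elim (use N(3) in \<open>auto simp: \<psi>_def\<close>)
  then obtain r1 where r1: "r1 > 0" "\<And>t. \<lbrakk>0 < t; t < r1\<rbrakk> \<Longrightarrow> xb + t *\<^sub>R u \<in> G \<inter> N \<and> f xb < \<psi> t"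
    unfolding eventually_at_right_field by auto
  define b where "b = Min {r1 / 2, 1 / (2 * \<alpha> + 1), \<epsilon> / (4 * (\<bar>\<mu>\<bar> * \<alpha> + 1))}"
  have b: "0 < b" "b \<le> r1 / 2" "b \<le> 1 / (2 * \<alpha> + 1)" "b \<le> \<epsilon> / (4 * (\<bar>\<mu>\<bar> * \<alpha> + 1))"
  proof -
    have "\<bar>\<mu>\<bar> * \<alpha> + 1 > 0" "2 * \<alpha> + 1 > 0" using \<alpha> by (simp_all add: add_nonneg_pos)
    then show "0 < b" using r1 \<epsilon> by (simp add: b_def)
  qed (unfold b_def, (rule Min_le; simp)+)
  have br: "b < r1" using b r1 by simp
  have \<alpha>b: "\<alpha> * b < 1" 
  proof -
    have "\<alpha> * b \<le> \<alpha> * (1 / (2 * \<alpha> + 1))" using b \<alpha> by (intro mult_left_mono) auto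
    also have "\<dots> < 1" using \<alpha> by (simp add: field_simps)
    finally show ?thesis .
  qed
  have \<mu>b: "\<bar>\<mu>\<bar> * \<alpha> * b \<le> \<epsilon> / 4"
  proof -
    have pos: "\<bar>\<mu>\<bar> * \<alpha> + 1 > 0" using \<alpha> by (simp add: add_nonneg_pos)
    have "\<bar>\<mu>\<bar> * \<alpha> * b \<le> (\<bar>\<mu>\<bar> * \<alpha> + 1) * b" using b(1) by (intro mult_right_mono) auto
    also have "\<dots> \<le> (\<bar>\<mu>\<bar> * \<alpha> + 1) * (\<epsilon> / (4 * (\<bar>\<mu>\<bar> * \<alpha> + 1)))"
      using b(4) pos by (intro mult_left_mono) auto
    also have "\<dots> = \<epsilon> / 4"
    proof -
      have "q * (\<epsilon> / (4 * q)) = \<epsilon> / 4" if "q > 0" for q using that by simp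
      from this[OF pos] show ?thesis .
    qed
    finally show ?thesis .
  qed
  have inGN: "xb + s *\<^sub>R u \<in> G \<inter> N" if "0 < s" "s \<le> b" for s using r1(2)[of s] that br by auto
  have "((\<lambda>t. \<psi> t) \<longlongrightarrow> f xb - \<mu> * 0) (at_right 0)"
    unfolding \<psi>_def
    using continuous_on_tendsto_compose[OF f tendsto_along_ray xb
      topological_tendstoD[OF tendsto_along_ray G(1) xb]] by (intro tendsto_intros)
  moreover have "f xb - \<mu> * 0 < \<psi> b" using r1(2)[OF b(1) br] by simp
  ultimately have "\<forall>\<^sub>F t in at_right 0. \<psi> t < \<psi> b" by (rule order_tendstoD(2))
  moreover have "\<forall>\<^sub>F t in at_right (0::real). t \<in> {0<..<b}" by (rule eventually_at_right_real[OF b(1)])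
  ultimately have "\<forall>\<^sub>F t in at_right 0. \<psi> t < \<psi> b \<and> t \<in> {0<..<b}" by (rule eventually_conj)
  from eventually_happens'[OF trivial_limit_at_right_real this]
  obtain a where a: "\<psi> a < \<psi> b" "0 < a" "a < b" by auto

  (* The minimiser sc is not b, because the value at a is smaller than the value at b; it may be a.
     This is enough, since moving in the homing direction moves away from a. *)
  have "continuous_on {a..b} \<psi>"
    unfolding \<psi>_def using inGN a by (intro continuous_intros continuous_on_compose2[OF f]) auto
  then obtain sc where sc: "sc \<in> {a..b}" "\<And>s. s \<in> {a..b} \<Longrightarrow> \<psi> sc \<le> \<psi> s"
    using continuous_attains_inf[of "{a..b}" \<psi>] a by auto
  have scb: "a \<le> sc" "sc < b" "0 < sc" using sc(1) sc(2)[of a] a by (auto simp: le_less)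
  define c0 where "c0 = xb + sc *\<^sub>R u"
  define S where "S = (\<lambda>s. xb + s *\<^sub>R u) ` {a..b}"
  obtain \<theta> L where \<theta>: "convex_on UNIV \<theta>" "L-lipschitz_on UNIV \<theta>"
    "\<And>s. \<lbrakk>0 \<le> s; s \<le> b\<rbrakk> \<Longrightarrow> \<theta> (xb + s *\<^sub>R u) = \<theta> xb - \<mu> * s"
    using affine_along_ray_convex_lipschitz[OF u] by blast
  have cont\<theta>: "continuous_on A \<theta>" for A
    using lipschitz_on_continuous_on[OF \<theta>(2)] continuous_on_subset by blast
  define F0 where "F0 x = f x + \<theta> x" for x
  have contF0: "continuous_on G F0" unfolding F0_def by (intro continuous_intros f cont\<theta>)
  have F0: "F0 (xb + s *\<^sub>R u) = \<psi> s + \<theta> xb" if "0 \<le> s" "s \<le> b" for s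
    using \<theta>(3)[OF that] by (simp add: F0_def \<psi>_def)
  have c0: "c0 \<in> S" "c0 \<in> G \<inter> N" using sc(1) inGN[of sc] scb by (auto simp: S_def c0_def)
  have SG: "S \<subseteq> G" using inGN a by (auto simp: S_def)
  have minS: "F0 c0 \<le> F0 x" if "x \<in> S" for x
    using that F0 sc scb a by (auto simp: S_def c0_def)
  have compS: "compact S" unfolding S_def by (intro compact_continuous_image continuous_intros) auto
  have convS: "convex S"
  proof -
    have "S = (+) xb ` (\<lambda>s. s *\<^sub>R u) ` {a..b}" by (simp add: S_def image_image)
    moreover have "convex ((\<lambda>s. s *\<^sub>R u) ` {a..b})"
      by (intro convex_linear_image) (auto intro: linearI simp: scaleR_add_left)
    ultimately show ?thesis by (simp add: convex_translation)
  qed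
  have neS: "S \<noteq> {}" using c0 by blast

  (* The neighbourhood of c0 found here is independent of the penalty constant K chosen below. *)
  define \<kappa> where "\<kappa> = 1 - \<alpha> * sc"
  have \<kappa>: "\<kappa> > 0" using \<alpha>b scb \<alpha> mult_left_mono[of sc b \<alpha>] by (simp add: \<kappa>_def)
  have wc: "w c0 = \<kappa> *\<^sub>R u" by (simp add: w_def c0_def \<kappa>_def algebra_simps)
  define \<tau>0 where "\<tau>0 = (b - sc) / \<kappa>"
  have \<tau>0: "\<tau>0 > 0" "\<tau>0 * \<kappa> = b - sc" using scb \<kappa> by (auto simp: \<tau>0_def)
  have "\<mu> * (\<alpha> * sc) \<le> \<bar>\<mu>\<bar> * (\<alpha> * b)"
    using \<alpha> scb by (intro mult_mono) auto
  then have \<mu>\<kappa>: "\<mu> - \<epsilon> / 4 \<le> \<mu> * \<kappa>" using \<mu>b by (simp add: \<kappa>_def algebra_simps)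
  define M where "M = \<epsilon> / 4 - \<mu> * \<kappa>"
  have "c0 + \<tau>0 *\<^sub>R w c0 = xb + b *\<^sub>R u"
  proof -
    have "c0 + \<tau>0 *\<^sub>R w c0 = xb + (sc + \<tau>0 * \<kappa>) *\<^sub>R u" unfolding wc by (simp add: c0_def algebra_simps)
    then show ?thesis by (simp add: \<tau>0)
  qed
  then have "\<theta> (c0 + \<tau>0 *\<^sub>R w c0) - \<theta> c0 = - \<mu> * (b - sc)"
    using \<theta>(3)[of b] \<theta>(3)[of sc] scb b by (simp add: c0_def algebra_simps)
  also have "\<dots> = - \<mu> * \<kappa> * \<tau>0" by (simp flip: \<tau>0(2))
  also have "\<dots> < M * \<tau>0" using \<tau>0 \<epsilon> by (intro mult_strict_right_mono) (auto simp: M_def)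
  finally have ev\<theta>: "\<forall>\<^sub>F x in nhds c0. \<forall>\<tau>. 0 < \<tau> \<longrightarrow> \<tau> \<le> \<tau>0 \<longrightarrow> \<theta> (x + \<tau> *\<^sub>R w x) - \<theta> x \<le> M * \<tau>"
    by (rule convex_difference_quotient_near[OF \<theta>(1) cont\<theta> contw \<tau>0(1)])
  have "\<exists>\<rho>>0. \<forall>x \<tau>. x \<in> ball c0 \<rho> \<longrightarrow> 0 < \<tau> \<longrightarrow> \<tau> \<le> \<rho>
      \<longrightarrow> infdist (x + \<tau> *\<^sub>R w x) S \<le> infdist x S"
    unfolding S_def c0_def w_def
    by (rule infdist_segment_homing_le[OF u \<alpha> less_imp_le[OF \<alpha>b] less_imp_le[OF a(2)] scb(1,2), of xb]) blast
  then obtain \<rho>1 where \<rho>1: "\<rho>1 > 0"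
    "\<And>x \<tau>. \<lbrakk>x \<in> ball c0 \<rho>1; 0 < \<tau>; \<tau> \<le> \<rho>1\<rbrakk> \<Longrightarrow> infdist (x + \<tau> *\<^sub>R w x) S \<le> infdist x S"
    by blast
  define B where "B = norm (w c0) + 1"
  have B: "B > 0" by (simp add: B_def add_nonneg_pos)
  have "isCont w c0" using contw by (simp add: continuous_on_eq_continuous_at)
  then have "((\<lambda>x. norm (w x)) \<longlongrightarrow> norm (w c0)) (nhds c0)"
    by (intro tendsto_norm isCont_tendsto_nhds)
  then have evB: "\<forall>\<^sub>F x in nhds c0. norm (w x) < B"
    by (rule order_tendstoD(2)) (simp add: B_def)
  have "\<forall>\<^sub>F x in nhds c0. x \<in> G \<inter> N"
    using c0 G N by (intro eventually_nhds_in_open open_Int) auto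
  from eventually_conj[OF eventually_conj[OF evB this] ev\<theta>]
  obtain \<rho>2 where \<rho>2: "\<rho>2 > 0" "\<And>x. dist x c0 < \<rho>2 \<Longrightarrow> norm (w x) < B \<and> x \<in> G \<inter> N
      \<and> (\<forall>\<tau>. 0 < \<tau> \<longrightarrow> \<tau> \<le> \<tau>0 \<longrightarrow> \<theta> (x + \<tau> *\<^sub>R w x) - \<theta> x \<le> M * \<tau>)"
    unfolding eventually_nhds_metric by auto
  define \<rho> where "\<rho> = min \<rho>1 \<rho>2"
  have \<rho>: "\<rho> > 0" using \<rho>1 \<rho>2 by (simp add: \<rho>_def)

  (* The segment being compact, F0 exceeds F0 c0 - \<delta> on a whole tube around it. With
     K = 4 \<delta> / \<eta>, a point of W where F does not exceed F c0 lies within \<eta>/4 of the segment, hence in the interior of the tube W; and \<delta> = e \<rho> / 2 keeps the point given by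
     Ekeland's principle within \<rho>/2 of c0. *)
  define e where "e = \<epsilon> / (4 * B)"
  have e: "e > 0" "e * B = \<epsilon> / 4" using \<epsilon> B by (auto simp: e_def)
  define \<delta> where "\<delta> = e * \<rho> / 2"
  have \<delta>: "\<delta> > 0" using e \<rho> by (simp add: \<delta>_def)
  have "open (G \<inter> F0 -` {F0 c0 - \<delta><..})"
    by (rule continuous_open_preimage[OF contF0 G(1)]) auto
  moreover have "S \<subseteq> G \<inter> F0 -` {F0 c0 - \<delta><..}" using minS SG \<delta> by fastforce
  ultimately obtain \<eta> where \<eta>: "\<eta> > 0" "(\<Union>x\<in>S. ball x \<eta>) \<subseteq> G \<inter> F0 -` {F0 c0 - \<delta><..}"
    using compact_subset_open_imp_ball_epsilon_subset[OF compS] by blast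
  define W where "W = {x. infdist x S \<le> \<eta> / 2}"
  have W: "x \<in> G" "F0 c0 - \<delta> < F0 x" if "x \<in> W" for x
  proof -
    have "infdist x S < \<eta>" using that \<eta>(1) by (auto simp: W_def)
    then obtain p where "p \<in> S" "dist x p < \<eta>"
      using cInf_lessD[of "dist x ` S" \<eta>] neS by (auto simp: infdist_notempty)
    then have "x \<in> (\<Union>x\<in>S. ball x \<eta>)" by (auto simp: dist_commute)
    with \<eta>(2) have "x \<in> G \<inter> F0 -` {F0 c0 - \<delta><..}" by (rule subsetD)
    then show "x \<in> G" "F0 c0 - \<delta> < F0 x" by auto
  qed
  define K where "K = 4 * \<delta> / \<eta>"
  have K: "K > 0" using \<delta> \<eta> by (simp add: K_def)
  define F where "F x = F0 x + K * infdist x S" for x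
  have cW: "c0 \<in> W" using c0(1) \<eta> by (simp add: W_def)
  have Fc0: "F c0 = F0 c0" using c0(1) by (simp add: F_def)
  obtain x1 where x1: "x1 \<in> W" "F x1 + e * dist c0 x1 \<le> F c0" "\<And>y. y \<in> W \<Longrightarrow> F x1 \<le> F y + e * dist x1 y"
  proof (rule ekeland_variational_principle[of W F "F0 c0 - \<delta>" c0 e])
    show "closed W" unfolding W_def by (intro closed_Collect_le continuous_intros)
    show "continuous_on W F"
      unfolding F_def using W(1) by (intro continuous_intros continuous_on_subset[OF contF0]) auto
    show "F0 c0 - \<delta> \<le> F y" if "y \<in> W" for y
      using W(2)[OF that] K infdist_nonneg[of y S] by (simp add: F_def add_increasing2)
  qed (use cW e in auto)
  have "0 \<le> e * dist c0 x1" "0 \<le> K * infdist x1 S"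
    using e K by (simp_all add: infdist_nonneg)
  then have inf1: "K * infdist x1 S < \<delta>" and "e * dist c0 x1 < \<delta>"
    using x1(2) W(2)[OF x1(1)] unfolding Fc0 unfolding F_def by linarith+
  then have x1c: "dist c0 x1 < \<rho> / 2" using e by (simp add: \<delta>_def)
  have "infdist x1 S < \<eta> / 4" using inf1 \<delta> \<eta> by (simp add: K_def field_simps)
  then have nearW: "y \<in> W" if "dist y x1 < \<eta> / 4" for y
    using infdist_triangle[of y S x1] that by (simp add: W_def)
  have x1G: "x1 \<in> G" "x1 \<in> N"
    using \<rho>2(2)[of x1] x1c \<rho> by (auto simp: \<rho>_def dist_commute)

  define \<phi> where "\<phi> x = \<theta> x + K * infdist x S + e * dist x1 x" for x
  have conv: "convex_on UNIV \<phi>"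
    unfolding \<phi>_def using K e
    by (intro convex_on_add convex_on_cmul \<theta>(1) convex_on_infdist convS neS convex_on_dist) auto
  have lip: "(L + K * 1 + e * 1)-lipschitz_on UNIV \<phi>"
    unfolding \<phi>_def
  proof (intro lipschitz_on_add lipschitz_on_cmult_real_nonneg \<theta>(2))
    show "1-lipschitz_on UNIV (\<lambda>x. infdist x S)"
      by (rule lipschitz_onI) (auto simp: dist_real_def infdist_triangle_abs)
    show "1-lipschitz_on UNIV (dist x1)"
      by (rule lipschitz_onI) (metis abs_dist_diff_le dist_commute dist_real_def mult_1, simp)
  qed (use K e in auto)
  have "\<forall>\<^sub>F y in nhds x1. f x1 + \<phi> x1 \<le> f y + \<phi> y"
    unfolding eventually_nhds_metric
  proof (intro exI[of _ "\<eta>/4"] conjI allI impI)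
    fix y assume "dist y x1 < \<eta> / 4"
    then show "f x1 + \<phi> x1 \<le> f y + \<phi> y"
      using x1(3)[OF nearW, of y] by (simp add: \<phi>_def F_def F0_def)
  qed (use \<eta> in auto)
  then obtain xs ys where sep: "xs \<in> limiting_subdifferential D (extend G f) x1"
      "ys \<in> clarke_subdifferential (extend G \<phi>) x1" "xs + ys = 0"
    by (rule separation_principle_real[OF sub G f conv lip x1G(1)])
  have "upper_subderivative (extend G \<phi>) x1 (w x1) \<le> ereal (M + e * B)"
  proof (rule upper_subderivative_extend_le[OF G(1) x1G(1)])
    show "isCont w x1" using contw by (simp add: continuous_on_eq_continuous_at)
    show "min \<tau>0 (\<rho> / 2) > 0" using \<tau>0 \<rho> by simp
    fix t y assume t: "0 < t" "t < min \<tau>0 (\<rho> / 2)" and y: "y \<in> ball x1 (min \<tau>0 (\<rho> / 2))"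
    have yc: "dist y c0 < \<rho>" using y x1c dist_triangle[of y c0 x1] by (simp add: dist_commute)
    have 1: "\<theta> (y + t *\<^sub>R w y) - \<theta> y \<le> M * t" and nw: "norm (w y) \<le> B"
      using \<rho>2(2)[of y] yc t by (auto simp: \<rho>_def)
    have 2: "infdist (y + t *\<^sub>R w y) S \<le> infdist y S"
      by (rule \<rho>1(2)) (use yc t \<rho> in \<open>auto simp: \<rho>_def dist_commute\<close>)
    have "dist x1 (y + t *\<^sub>R w y) \<le> dist x1 y + t * norm (w y)"
      using dist_triangle[of x1 "y + t *\<^sub>R w y" y] t by (simp add: dist_norm)
    also have "\<dots> \<le> dist x1 y + t * B" using nw t by simp
    finally have "e * dist x1 (y + t *\<^sub>R w y) \<le> e * (dist x1 y + t * B)" using e by (intro mult_left_mono) auto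
    moreover have "K * infdist (y + t *\<^sub>R w y) S \<le> K * infdist y S"
      using 2 K by (intro mult_left_mono) auto
    moreover have "\<phi> (y + t *\<^sub>R w y) - \<phi> y = (\<theta> (y + t *\<^sub>R w y) - \<theta> y)
        + (K * infdist (y + t *\<^sub>R w y) S - K * infdist y S)
        + (e * dist x1 (y + t *\<^sub>R w y) - e * dist x1 y)"
      by (simp add: \<phi>_def)
    moreover have "(M + e * B) * t = M * t + (e * (dist x1 y + t * B) - e * dist x1 y)"
      by (simp add: algebra_simps)
    ultimately show "\<phi> (y + t *\<^sub>R w y) - \<phi> y \<le> (M + e * B) * t" using 1 by linarith
  qed
  moreover have "ereal (blinfun_apply ys (w x1)) \<le> upper_subderivative (extend G \<phi>) x1 (w x1)"
    using sep(2) unfolding clarke_subdifferential_def by blast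
  ultimately have "blinfun_apply ys (w x1) \<le> M + e * B"
    using order_trans ereal_less_eq(3) by blast
  moreover have "blinfun_apply xs (w x1) = - blinfun_apply ys (w x1)"
    using sep(3) by (simp add: eq_neg_iff_add_eq_0[symmetric] blinfun.minus_left add_eq_0_iff2)
  ultimately have "\<mu> - \<epsilon> < blinfun_apply xs (u + \<alpha> *\<^sub>R (xb - x1))"
    using \<mu>\<kappa> e(2) \<epsilon> by (simp add: M_def w_def)
  then show thesis using that x1G(2) sep(1) by blast
qed


section \<open>Functions determined by their subdifferentials\<close>

text \<open>
  If numbers \<open>m0 < m\<close> separated the two sides for some \<open>\<alpha>\<close>, then in the homing direction all
  subgradients of \<open>g\<close> at points near the ray would have values below about \<open>m0\<close>, whereas \<open>f\<close> supplies limiting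
  subgradients with values close to \<open>m\<close>.
\<close>

lemma radial_le_natural_subderivative:
  fixes f g :: "'a::banach \<Rightarrow> real"
  assumes sub: "is_subdifferential G D" and G: "open G" "convex G"
    and fg: "continuous_on G f" "continuous_on G g"
    and \<Omega>: "open \<Omega>" "\<Omega> \<subseteq> G" "\<And>x. x \<in> \<Omega> \<Longrightarrow> D (extend G f) x \<subseteq> D (extend G g) x"
    and xb: "xb \<in> \<Omega>" and u: "u \<noteq> 0"
  shows "radial_subderivative (extend G f) xb u \<le> natural_subderivative (extend G g) xb u"
proof -
  have "radial_subderivative (extend G f) xb u
      \<le> Limsup (at_direction xb u) (\<lambda>x. radial_subderivative (extend G g) x (u + \<alpha> *\<^sub>R (xb - x)))"
    (is "?r \<le> ?L") if \<alpha>: "\<alpha> \<ge> 0" for \<alpha>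
  proof (rule ccontr)
    assume "\<not> ?r \<le> ?L"
    then have "?L < ?r" by simp
    then obtain m0 where m0: "?L < ereal m0" "ereal m0 < ?r" using ereal_dense2 by blast
    then obtain m where m: "ereal m0 < ereal m" "ereal m < ?r" using ereal_dense2 by blast
    define \<epsilon> where "\<epsilon> = (m - m0) / 2"
    have \<epsilon>: "\<epsilon> > 0" "m0 + \<epsilon> = m - \<epsilon>" using m(1) by (auto simp: \<epsilon>_def field_simps)
    have "\<forall>\<^sub>F x in at_direction xb u. radial_subderivative (extend G g) x (u + \<alpha> *\<^sub>R (xb - x)) < ereal m0"
      by (rule Limsup_lessD[OF m0(1)])
    then obtain N r where N: "open N" "r > 0" "\<And>t. \<lbrakk>0 < t; t < r\<rbrakk> \<Longrightarrow> xb + t *\<^sub>R u \<in> N"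
      "\<And>x. x \<in> N \<Longrightarrow> radial_subderivative (extend G g) x (u + \<alpha> *\<^sub>R (xb - x)) < ereal m0"
      using directional_neighbourhood by blast
    have "isCont (\<lambda>t. xb + t *\<^sub>R u) 0" by (intro continuous_intros)
    from topological_tendstoD[OF isCont_tendsto_nhds[OF this] \<Omega>(1)] xb
    obtain r' where r': "r' > 0" "\<And>t. dist t 0 < r' \<Longrightarrow> xb + t *\<^sub>R u \<in> \<Omega>"
      unfolding eventually_nhds_metric by auto
    obtain c xs where c: "c \<in> N \<inter> \<Omega>" "xs \<in> limiting_subdifferential D (extend G f) c"
      "m - \<epsilon> < blinfun_apply xs (u + \<alpha> *\<^sub>R (xb - c))"
    proof (rule separation_at_directional_point[OF sub G fg(1) _ u \<alpha> m(2), of "N \<inter> \<Omega>" "min r r'" \<epsilon>])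
      show "xb + t *\<^sub>R u \<in> N \<inter> \<Omega>" if "0 < t" "t < min r r'" for t
        using N(3)[of t] r'(2)[of t] that by simp
    qed (use xb \<Omega> N r' \<epsilon> in auto)
    have "blinfun_apply xs (u + \<alpha> *\<^sub>R (xb - c)) \<le> m0 + \<epsilon>"
    proof (rule limiting_subdifferential_homing_le[OF c(2) _ c(1) \<alpha>])
      fix x ys assume x: "x \<in> N \<inter> \<Omega>" and "ys \<in> D (extend G f) x"
      then have "ys \<in> D (extend G g) x" using \<Omega>(3) by blast
      then have "ys \<in> clarke_subdifferential (extend G g) x"
        using sub extend_in_extended_functions unfolding is_subdifferential_def by blast
      then have "ereal (blinfun_apply ys (u + \<alpha> *\<^sub>R (xb - x)))
          \<le> upper_subderivative (extend G g) x (u + \<alpha> *\<^sub>R (xb - x))"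
        unfolding clarke_subdifferential_def by blast
      also have "\<dots> \<le> ereal (m0 + \<epsilon>)"
        by (rule upper_subderivative_le_radial_bound[OF G(1) fg(2), of "N \<inter> \<Omega>"])
          (use N \<Omega> \<alpha> x \<epsilon> in auto)
      finally show "blinfun_apply ys (u + \<alpha> *\<^sub>R (xb - x)) \<le> m0 + \<epsilon>" by simp
    qed (use N \<Omega> in auto)
    then show False using c(3) \<epsilon> by simp
  qed
  moreover have "xb \<in> edom (extend G g)" using xb \<Omega> by (auto simp: edom_def extend_def)
  ultimately show ?thesis unfolding natural_subderivative_def by (auto intro: INF_greatest)
qed

text \<open>
  The lower limit is superadditive, so the lower Dini derivative of \<open>f - g\<close> is at most the difference
  of those of \<open>f\<close> and \<open>g\<close> wherever the latter is finite, hence nonpositive almost everywhere. The term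
  \<open>- \<epsilon> t\<close> makes it strictly negative.
\<close>

lemma diff_le_on_segment:
  fixes f g :: "'a::banach \<Rightarrow> real"
  assumes G: "open G" and seg: "closed_segment p (p + v) \<subseteq> G" and fg: "f \<in> CLACG G" "g \<in> CLACG G"
    and ae: "AE t in lebesgue_on {0..1}. \<bar>radial_subderivative (extend G g) (p + t *\<^sub>R v) v\<bar> \<noteq> \<infinity>
        \<and> radial_subderivative (extend G f) (p + t *\<^sub>R v) v \<le> radial_subderivative (extend G g) (p + t *\<^sub>R v) v"
  shows "f (p + v) - g (p + v) \<le> f p - g p"
proof (rule field_le_epsilon)
  fix \<epsilon> :: real assume \<epsilon>: "\<epsilon> > 0"
  let ?\<phi> = "\<lambda>t. f (p + t *\<^sub>R v)" and ?\<gamma> = "\<lambda>t. g (p + t *\<^sub>R v)"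
  define h where "h t = ?\<phi> t - ?\<gamma> t - \<epsilon> * t" for t
  have ACG: "ACG_on {0..1} ?\<phi>" "ACG_on {0..1} ?\<gamma>"
  proof -
    have *: "ACG_on {0..1} (\<lambda>t. f (p + t *\<^sub>R (p + v - p)))" if "f \<in> CLACG G" for f
      using that seg unfolding CLACG_def by blast
    show "ACG_on {0..1} ?\<phi>" "ACG_on {0..1} ?\<gamma>" using *[OF fg(1)] *[OF fg(2)] by simp_all
  qed
  have inG: "p + t *\<^sub>R v \<in> G" if "0 \<le> t" "t \<le> 1" for t
    using seg that by (force simp: closed_segment_def algebra_simps)
  define E where "E = {t\<in>{0..1}. \<not> (\<bar>radial_subderivative (extend G g) (p + t *\<^sub>R v) v\<bar> \<noteq> \<infinity>
        \<and> radial_subderivative (extend G f) (p + t *\<^sub>R v) v \<le> radial_subderivative (extend G g) (p + t *\<^sub>R v) v)}"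
  have "AE t in lebesgue. t \<in> {0..1} \<longrightarrow> \<bar>radial_subderivative (extend G g) (p + t *\<^sub>R v) v\<bar> \<noteq> \<infinity>
        \<and> radial_subderivative (extend G f) (p + t *\<^sub>R v) v \<le> radial_subderivative (extend G g) (p + t *\<^sub>R v) v"
    using ae by (subst (asm) AE_restrict_space_iff) auto
  then have "AE t in lebesgue. t \<notin> E" by eventually_elim (auto simp: E_def)
  then obtain N where "N \<in> null_sets lebesgue" "\<And>t. t \<in> space lebesgue - N \<Longrightarrow> t \<notin> E"
    by (rule AE_E3) blast
  then have "negligible E"
    using negligible_subset[of N E] by (auto simp: negligible_iff_null_sets)
  then have null: "negligible (h ` E)"
    unfolding h_def by (rule ACG_on_diff_linear_negligible_image[OF ACG]) (auto simp: E_def)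
  have "h 1 \<le> h 0"
  proof (rule growth_off_negligible_image[where h = h and a = 0 and b = 1, OF _ _ null])
    show "continuous_on {0..1} h"
      unfolding h_def using ACG by (intro continuous_intros) (auto simp: ACG_on_def)
    fix s :: real assume s: "0 \<le> s" "s < 1" "s \<notin> E"
    define z where "z = p + s *\<^sub>R v"
    have z: "z \<in> G" unfolding z_def using inG s by auto
    obtain k where k: "radial_subderivative (extend G g) z v = ereal k"
        "radial_subderivative (extend G f) z v \<le> ereal k"
      using s unfolding E_def z_def by (cases "radial_subderivative (extend G g) (p + s *\<^sub>R v) v") auto
    have "ereal (k - \<epsilon>/2) < radial_subderivative (extend G g) z v" using k \<epsilon> by simp
    from radial_subderivative_extend_greaterD[OF G z this]
    obtain b where b: "b > 0" "\<And>t. 0 < t \<Longrightarrow> t < b \<Longrightarrow> (k - \<epsilon>/2) * t < g (z + t *\<^sub>R v) - g z"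
      unfolding eventually_at_right_field by auto
    have "radial_subderivative (extend G f) z v < ereal (k + \<epsilon>/2)" using k(2) \<epsilon> by (simp add: order.strict_trans1)
    then obtain t where t: "0 < t" "t < min b (1 - s)" "z + t *\<^sub>R v \<in> G" "f (z + t *\<^sub>R v) - f z < (k + \<epsilon>/2) * t"
      using radial_subderivative_extend_lessD[OF G z, of f v _ "min b (1 - s)"] b s by auto
    have "(k - \<epsilon>/2) * t < g (z + t *\<^sub>R v) - g z" using b(2) t by simp
    moreover have "z + t *\<^sub>R v = p + (s + t) *\<^sub>R v" by (simp add: z_def algebra_simps)
    ultimately have "h (s + t) < h s" using t(4) by (simp add: h_def z_def algebra_simps)
    then show "\<exists>s'>s. s' \<le> 1 \<and> h s' < h s" using t by (intro exI[of _ "s + t"]) auto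
  qed auto
  then show "f (p + v) - g (p + v) \<le> f p - g p + \<epsilon>" by (simp add: h_def)
qed

theorem theorem5p2:
  fixes G :: "'a::banach set"
    and D :: "('a \<Rightarrow> ereal) \<Rightarrow> 'a \<Rightarrow> ('a \<Rightarrow>\<^sub>L real) set"
  assumes "G \<noteq> {}" and "open G" and "convex G"
    and "is_subdifferential G D"
  shows "subdifferentially_determined_in G D (CLACG_natural_ad G) (CLACG G)"
  unfolding subdifferentially_determined_in_def
proof (intro ballI allI impI, elim conjE)
  fix g f \<Omega>
  assume gad: "g \<in> CLACG_natural_ad G" and f: "f \<in> CLACG G" and \<Omega>: "\<Omega> \<noteq> {}" "open \<Omega>" "convex \<Omega>" "\<Omega> \<subseteq> G"
    and D: "\<forall>x\<in>\<Omega>. D (extend G f) x \<subseteq> D (extend G g) x"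
  have g: "g \<in> CLACG G" using gad by (simp add: CLACG_natural_ad_def)
  have cont: "continuous_on G f" "continuous_on G g" using f g by (auto simp: CLACG_def)
  have mono: "f y - g y \<le> f x - g x" if xy: "x \<in> \<Omega>" "y \<in> \<Omega>" for x y
  proof -
    have "closed_segment x (x + (y - x)) \<subseteq> G"
      using closed_segment_subset[OF xy \<Omega>(3)] \<Omega>(4) by simp
    then obtain X U where XU: "X \<longlonglongrightarrow> x" "U \<longlonglongrightarrow> y - x"
      and ae: "\<And>n::nat. AE t in lebesgue_on {0..1}.
              \<bar>radial_subderivative (extend G g) (X n + t *\<^sub>R U n) (U n)\<bar> \<noteq> \<infinity>
              \<and> natural_subderivative (extend G g) (X n + t *\<^sub>R U n) (U n)
                = radial_subderivative (extend G g) (X n + t *\<^sub>R U n) (U n)"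
      using gad unfolding CLACG_natural_ad_def by blast
    have XU': "(\<lambda>n. X n + U n) \<longlonglongrightarrow> y" using tendsto_add[OF XU] by simp
    have in\<Omega>: "\<forall>\<^sub>F n in sequentially. X n \<in> \<Omega> \<and> X n + U n \<in> \<Omega>"
      using topological_tendstoD[OF XU(1) \<Omega>(2) xy(1)] topological_tendstoD[OF XU' \<Omega>(2) xy(2)]
      by (rule eventually_conj)
    have "\<forall>\<^sub>F n in sequentially. f (X n + U n) - g (X n + U n) \<le> f (X n) - g (X n)"
      using in\<Omega>
    proof eventually_elim
      case (elim n)
      then have seg: "closed_segment (X n) (X n + U n) \<subseteq> \<Omega>" using \<Omega>(3) by (simp add: closed_segment_subset)
      show ?case
      proof (cases "U n = 0")
        case False
        show ?thesis
        proof (rule diff_le_on_segment[OF assms(2) _ f g])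
          have "radial_subderivative (extend G f) (X n + t *\<^sub>R U n) (U n)
              \<le> natural_subderivative (extend G g) (X n + t *\<^sub>R U n) (U n)" if "t \<in> {0..1}" for t
          proof (rule radial_le_natural_subderivative[OF assms(4,2,3) cont \<Omega>(2,4) _ _ False])
            show "X n + t *\<^sub>R U n \<in> \<Omega>"
              using seg that by (force simp: closed_segment_def algebra_simps)
          qed (use D in auto)
          then have "AE t in lebesgue_on {0..1}. radial_subderivative (extend G f) (X n + t *\<^sub>R U n) (U n)
              \<le> natural_subderivative (extend G g) (X n + t *\<^sub>R U n) (U n)"
            by (intro AE_I2) (auto simp: space_restrict_space)
          with ae[of n] show "AE t in lebesgue_on {0..1}.
              \<bar>radial_subderivative (extend G g) (X n + t *\<^sub>R U n) (U n)\<bar> \<noteq> \<infinity>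
              \<and> radial_subderivative (extend G f) (X n + t *\<^sub>R U n) (U n)
                \<le> radial_subderivative (extend G g) (X n + t *\<^sub>R U n) (U n)"
            by eventually_elim simp
        qed (use seg \<Omega>(4) in auto)
      qed simp
    qed
    moreover have lim: "(\<lambda>n. f (Y n) - g (Y n)) \<longlonglongrightarrow> f z - g z" if "Y \<longlonglongrightarrow> z" "z \<in> \<Omega>" for Y z
    proof -
      have "isCont (\<lambda>x. f x - g x) z"
        using continuous_on_diff[OF cont] assms(2) \<Omega>(4) that(2) by (metis continuous_on_eq_continuous_at subsetD)
      then show ?thesis using that(1) by (rule isCont_tendsto_compose)
    qed
    ultimately show ?thesis
      using tendsto_le[OF trivial_limit_sequentially lim[OF XU(1) xy(1)] lim[OF XU' xy(2)]] by blast
  qed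
  obtain x0 where "x0 \<in> \<Omega>" using \<Omega>(1) by blast
  then show "\<exists>c. \<forall>x\<in>\<Omega>. f x = g x + c"
    using mono by (intro exI[of _ "f x0 - g x0"]) (force intro: antisym)
qed

end
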